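(* Let $\tau\in\mathbb{C}$ with $\mathrm{Im}(\tau)>0$, $q=e^{i\pi\tau}$ (with $q^{s}=e^{i\pi\tau s}$), and let $z=\tfrac12+\alpha+\beta\tau$ with $(\alpha,\beta)\in\mathbb{R}^2$. Put $CN(z,\tau)=\frac{Kk}{2\pi}\,\mathrm{cn}(2Kz)$. If $|\beta|<\tfrac12$, then $$CN(z,\tau)=\sum_{n=0}^{+\infty}\frac{q^{n+\frac12}\cos((2n+1)\pi z)}{1+q^{2n+1}}=\frac12\sum_{n=0}^{+\infty}\frac{\cos((2n+1)\pi z)}{\cos((n+\frac12)\pi\tau)},$$ and if $|\alpha|<\tfrac12$, then $$CN(z,\tau)=\frac{1}{2\tau}\sum_{n=0}^{+\infty}\frac{(-1)^n\sin\left((n+\frac12)\pi(2z-1)/\tau\right)}{\cos\left((n+\frac12)\pi/\tau\right)}.$$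
   Context: The Jacobi functions are taken with parameter $\tau=iK'/K$ and nome $q=e^{i\pi\tau}$. Explicitly, with $q^s=e^{i\pi\tau s}$, let $\theta_1(v)=2\sum_{n\ge0}(-1)^nq^{(n+1/2)^2}\sin((2n+1)v)$, $\theta_2(v)=2\sum_{n\ge0}q^{(n+1/2)^2}\cos((2n+1)v)$, $\theta_3(v)=1+2\sum_{n\ge1}q^{n^2}\cos(2nv)$, $\theta_4(v)=1+2\sum_{n\ge1}(-1)^nq^{n^2}\cos(2nv)$, and $\theta_j=\theta_j(0)$. Then $k=\theta_2^2/\theta_3^2$, $k'=\theta_4^2/\theta_3^2$, $K=\frac{\pi}{2}\theta_3^2$, and $\mathrm{cn}(2Kz)=\frac{\theta_4}{\theta_2}\frac{\theta_2(\pi z)}{\theta_4(\pi z)}$. When $\tau$ is purely imaginary these are the classical Jacobi modulus, complete elliptic integral and function $\mathrm{cn}$. *)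

theory Defs
  imports Complex_Main
begin

text \<open>
  \<open>nome_pow \<tau> s\<close> is $q^s = e^{i\pi\tau s}$. Real powers of the nome depend on \<open>\<tau>\<close> and not only on
  $q = e^{i\pi\tau}$, so \<open>powr\<close> (principal branch) applied to \<open>q\<close> would not do.
\<close>

definition nome_pow :: "complex \<Rightarrow> real \<Rightarrow> complex" where
  "nome_pow \<tau> s = exp (\<i> * of_real pi * \<tau> * of_real s)"

definition theta2 :: "complex \<Rightarrow> complex \<Rightarrow> complex" where
  "theta2 \<tau> v = 2 * (\<Sum>n. nome_pow \<tau> ((real n + 1/2)\<^sup>2) * cos (of_nat (2 * n + 1) * v))"

definition theta3 :: "complex \<Rightarrow> complex \<Rightarrow> complex" where
  "theta3 \<tau> v = 1 + 2 * (\<Sum>n. nome_pow \<tau> ((real (Suc n))\<^sup>2) * cos (of_nat (2 * Suc n) * v))"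

definition theta4 :: "complex \<Rightarrow> complex \<Rightarrow> complex" where
  "theta4 \<tau> v =
     1 + 2 * (\<Sum>n. (-1) ^ Suc n * nome_pow \<tau> ((real (Suc n))\<^sup>2) * cos (of_nat (2 * Suc n) * v))"

definition modulus_k :: "complex \<Rightarrow> complex" where
  "modulus_k \<tau> = (theta2 \<tau> 0)\<^sup>2 / (theta3 \<tau> 0)\<^sup>2"

definition quarter_K :: "complex \<Rightarrow> complex" where
  "quarter_K \<tau> = of_real pi / 2 * (theta3 \<tau> 0)\<^sup>2"

text \<open>
  The argument is the classical one, \<open>u = 2 K z\<close>; thus \<open>\<pi> z = \<pi> u / (2 K)\<close>, where \<open>K \<noteq> 0\<close>
  whenever \<open>Im \<tau> > 0\<close>.
\<close>

definition jacobi_cn :: "complex \<Rightarrow> complex \<Rightarrow> complex" where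
  "jacobi_cn \<tau> u =
     theta4 \<tau> 0 / theta2 \<tau> 0 *
     (theta2 \<tau> (of_real pi * (u / (2 * quarter_K \<tau>))) /
      theta4 \<tau> (of_real pi * (u / (2 * quarter_K \<tau>))))"

definition CN :: "complex \<Rightarrow> complex \<Rightarrow> complex" where
  "CN z \<tau> = quarter_K \<tau> * modulus_k \<tau> / (2 * of_real pi) * jacobi_cn \<tau> (2 * quarter_K \<tau> * z)"

end

theory Submission
  imports Defs "HOL-Complex_Analysis.Complex_Analysis"
begin

text \<open>
  Let \<open>2 F(z)\<close> be the bilateral series $\sum_n q^{n+1/2} e^{(2n+1)\pi i z}/(1+q^{2n+1})$. The coefficients
  of the product $F(z)\,\theta_4(\pi z)$ satisfy the same two-term recurrence as those of $\theta_2(\pi z)$,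
  so $F\theta_4 = C\,\theta_2$ with $C$ independent of $z$. Letting $z \to \tau/2$, where $F$ has a
  simple pole and $\theta_4$ a simple zero, evaluates $C$ as a quotient of infinite products, and the
  Jacobi triple product together with Euler's identity
  $\prod (1+q^{2n})(1+q^{2n-1})(1-q^{2n-1}) = 1$ gives $C = \theta_2\theta_4/4$. The triple product also
  locates the zeros of the theta functions.

  The $\sin$ series follows from the $\cos$ series by the residue theorem applied to
  $\pi\sin(\pi w(2z-1))/(\cos(\pi w)\cos(\pi\tau w))$, when \<open>\<bar>\<alpha>\<bar>\<close> and \<open>\<bar>\<beta>\<bar>\<close> are both less than $1/2$. Since
  both sides change sign under $z \mapsto z+\tau$, continuity in \<open>\<beta>\<close> removes the restriction on \<open>\<beta>\<close>.
\<close>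

subsection \<open>Series over the integers\<close>

text \<open>As \<tau> is any point of the upper half plane, the natural directions are 1 and \<tau>,
  or 1 and 1/\<tau> for the residue argument, instead of the real and imaginary axes. With s = 2z -
  1 = 2\<alpha> + 2\<beta>\<tau>, the kernel is small on the edge parallel to 1/\<tau> because
  |2\<beta>| < 1, and on the edge parallel to 1 because |2\<alpha>| < 1: hence the double
  restriction. In the sine series \<beta> enters only as a real translation of the argument, so
  convergence is uniform in \<beta>, which makes the continuation possible.

  The recurrence for the coefficients of F \<theta>_4 is easy, since a combination of neighbours
  clears all denominators. Its initial value is a series with no evident closed form, which forces
  the detour through the pole. That pole lies on the boundary of the strip where F converges, so the
  limit is taken from inside with explicit bounds.

  The triple product meets the same obstacle: one constant stays unknown, and it is found from a
  family of series for it, indexed by N, as N tends to infinity.\<close>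

lemma UNIV_int_halves: "UNIV = range int \<union> range (\<lambda>n. - int n - 1)"
proof -
  have "x \<in> range int \<union> range (\<lambda>n. - int n - 1)" for x
  proof (cases "x \<ge> 0")
    case True
    then have "x = int (nat x)" by simp
    then show ?thesis by blast
  next
    case False
    then have "x = - int (nat (- x - 1)) - 1" by simp
    then show ?thesis by blast
  qed
  then show ?thesis by blast
qed

lemma summable_on_intI:
  fixes f :: "int \<Rightarrow> complex"
  assumes "summable (\<lambda>n. norm (f (int n)))" "summable (\<lambda>n. norm (f (- int n - 1)))"
  shows "f summable_on UNIV"
proof -
  have "f summable_on range int"
    by (subst summable_on_reindex) (use assms in \<open>auto simp: o_def intro: norm_summable_imp_summable_on\<close>)
  moreover have "f summable_on range (\<lambda>n. - int n - 1)"
    by (subst summable_on_reindex)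
      (use assms in \<open>auto simp: o_def inj_on_def intro: norm_summable_imp_summable_on\<close>)
  moreover have "range int \<inter> range (\<lambda>n. - int n - 1) = {}"
    by auto
  ultimately have "f summable_on (range int \<union> range (\<lambda>n. - int n - 1))"
    by (rule summable_on_Un_disjoint)
  then show ?thesis by (simp add: UNIV_int_halves)
qed

lemma summable_on_int_halves:
  fixes f :: "int \<Rightarrow> complex"
  assumes "f summable_on UNIV"
  shows "summable (\<lambda>n. norm (f (int n)))" "summable (\<lambda>n. norm (f (- int n - 1)))"
proof -
  have *: "(\<lambda>n. norm (f (g n))) summable_on UNIV" if "inj g" for g :: "nat \<Rightarrow> int"
  proof -
    have "f summable_on range g"
      by (rule summable_on_subset_banach[OF assms]) simp
    then show ?thesis
      using that by (simp add: summable_on_reindex summable_on_iff_abs_summable_on_complex o_def)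
  qed
  show "summable (\<lambda>n. norm (f (int n)))" "summable (\<lambda>n. norm (f (- int n - 1)))"
    using *[of int] *[of "\<lambda>n. - int n - 1"]
    by (auto intro!: summable_on_imp_summable simp: inj_on_def)
qed

lemma infsum_int_eq_suminf:
  fixes f :: "int \<Rightarrow> complex"
  assumes "f summable_on UNIV"
  shows "infsum f UNIV = (\<Sum>n. f (int n)) + (\<Sum>n. f (- int n - 1))"
proof -
  have 1: "infsum f (range g) = (\<Sum>n. f (g n))" if "inj g" for g :: "nat \<Rightarrow> int"
  proof -
    have "f summable_on range g"
      by (rule summable_on_subset_banach[OF assms]) simp
    then have "(f \<circ> g) summable_on UNIV"
      using that by (simp add: summable_on_reindex)
    then have "(\<lambda>n. f (g n)) sums infsum (f \<circ> g) UNIV"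
      using has_sum_imp_sums has_sum_infsum by (fastforce simp: o_def)
    then show ?thesis
      using that by (simp add: infsum_reindex sums_iff o_def)
  qed
  have "infsum f UNIV = infsum f (range int) + infsum f (range (\<lambda>n. - int n - 1))"
    unfolding UNIV_int_halves
    by (rule infsum_Un_disjoint) (auto intro: summable_on_subset_banach[OF assms])
  then show ?thesis
    using 1[of int] 1[of "\<lambda>n. - int n - 1"] by (simp add: inj_on_def)
qed

text \<open>The partner of n is -n-1 and not -n: this reflection sends the odd frequency 2n+1 to its
  negative, so paired exponentials become the cosines of \<theta>_2 and of the Fourier
  series.\<close>

lemma int_sums_paired:
  fixes f :: "int \<Rightarrow> complex"
  assumes "f summable_on UNIV"
  shows "(\<lambda>n. f (int n) + f (- int n - 1)) sums infsum f UNIV"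
  unfolding infsum_int_eq_suminf[OF assms]
  using summable_on_int_halves[OF assms, THEN summable_norm_cancel]
  by (intro sums_add summable_sums)

lemma infsum_shift_int:
  fixes f :: "int \<Rightarrow> complex"
  shows "infsum (\<lambda>n. f (n + k)) UNIV = infsum f UNIV"
    "(\<lambda>n. f (n + k)) summable_on UNIV \<longleftrightarrow> f summable_on UNIV"
proof -
  have "bij_betw (\<lambda>n. n + k) UNIV UNIV"
    by (rule bij_betwI[where g = "\<lambda>n. n - k"]) auto
  from infsum_reindex_bij_betw[OF this, of f] summable_on_reindex_bij_betw[OF this, of f]
  show "infsum (\<lambda>n. f (n + k)) UNIV = infsum f UNIV"
    "(\<lambda>n. f (n + k)) summable_on UNIV \<longleftrightarrow> f summable_on UNIV" by auto
qed

lemma infsum_uminus_int: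
  fixes f :: "int \<Rightarrow> complex"
  shows "infsum (\<lambda>n. f (- n)) UNIV = infsum f UNIV"
    "(\<lambda>n. f (- n)) summable_on UNIV \<longleftrightarrow> f summable_on UNIV"
proof -
  have "bij_betw (\<lambda>n :: int. - n) UNIV UNIV"
    by (rule bij_betwI[where g = "\<lambda>n. - n"]) auto
  from infsum_reindex_bij_betw[OF this, of f] summable_on_reindex_bij_betw[OF this, of f]
  show "infsum (\<lambda>n. f (- n)) UNIV = infsum f UNIV"
    "(\<lambda>n. f (- n)) summable_on UNIV \<longleftrightarrow> f summable_on UNIV" by auto
qed

text \<open>The Cauchy product of Laurent series: N is the exponent in the product and m the
  exponent in the left factor. Both the triple product and the recurrence for F \<theta>_4 compare
  such coefficients.\<close>

lemma int_convolution:
  fixes f g :: "int \<Rightarrow> complex"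
  assumes f: "f summable_on UNIV" and g: "g summable_on UNIV"
  shows "((\<lambda>N. \<Sum>\<^sub>\<infinity>m. f m * g (N - m)) has_sum (infsum f UNIV * infsum g UNIV)) UNIV"
    and "(\<lambda>m. f m * g (N - m)) summable_on UNIV"
proof -
  have fg: "(\<lambda>n. norm (f n)) summable_on UNIV" "(\<lambda>n. norm (g n)) summable_on UNIV"
    using f g by (simp_all add: summable_on_iff_abs_summable_on_complex)
  have "(\<lambda>x. norm (case x of (m, n) \<Rightarrow> f m * g n)) summable_on (UNIV \<times> UNIV)"
    unfolding Infinite_Sum.abs_summable_on_Sigma_iff
    using fg by (auto simp: norm_mult infsum_cmult_right' abs_mult infsum_nonneg intro!: summable_on_cmult_right summable_on_cmult_left)
  then have S: "(\<lambda>(m, n). f m * g n) summable_on (UNIV \<times> UNIV)"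
    by (rule Infinite_Sum.abs_summable_summable)
  have H: "((\<lambda>(m, n). f m * g n) has_sum (infsum f UNIV * infsum g UNIV)) (UNIV \<times> UNIV)"
    by (rule has_sum_SigmaI[OF _ _ S, where g = "\<lambda>m. f m * infsum g UNIV"])
      (auto intro!: has_sum_cmult_right has_sum_cmult_left has_sum_infsum f g)
  \<comment> \<open>The shear from (N, m) to (m, N - m) regroups the absolutely convergent double
    series along its antidiagonals.\<close>
  have bij: "bij_betw (\<lambda>(N, m). (m, N - m)) (UNIV \<times> UNIV) (UNIV \<times> (UNIV :: int set))"
    by (rule bij_betwI[where g = "\<lambda>(m, n). (n + m, m)"]) auto
  have H': "((\<lambda>(N, m). f m * g (N - m)) has_sum (infsum f UNIV * infsum g UNIV)) (UNIV \<times> UNIV)"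
    using has_sum_reindex_bij_betw[OF bij, of "\<lambda>(m, n). f m * g n"] H
    by (simp add: case_prod_unfold)
  then have S': "(\<lambda>(N, m). f m * g (N - m)) summable_on (UNIV \<times> UNIV)"
    by (auto simp: summable_on_def)
  have inner: "(\<lambda>m. f m * g (N - m)) summable_on UNIV" for N
    using summable_on_SigmaD1[OF S', of N] by simp
  then show "(\<lambda>m. f m * g (N - m)) summable_on UNIV" .
  show "((\<lambda>N. \<Sum>\<^sub>\<infinity>m. f m * g (N - m)) has_sum (infsum f UNIV * infsum g UNIV)) UNIV"
    by (rule has_sum_SigmaD[OF H']) (use inner in auto)
qed

text \<open>This is the coefficient of exponent 0 in the product of f with the reflected g, so the
  convolution already contains it.\<close>

lemma summable_on_mult_int:
  fixes f g :: "int \<Rightarrow> complex"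
  assumes "f summable_on UNIV" "g summable_on UNIV"
  shows "(\<lambda>m. f m * g m) summable_on UNIV"
  using int_convolution(2)[OF assms(1) infsum_uminus_int(2)[THEN iffD2, OF assms(2)], of 0] by simp

text \<open>Solves first-order recurrences in both directions: divided by an explicit nonvanishing
  solution, a sequence that obeys the recurrence has equal neighbours.\<close>

lemma int_const_of_step:
  fixes g :: "int \<Rightarrow> 'a"
  assumes "\<And>n. g n = g (n - 1)"
  shows "g n = g 0"
proof (induction n rule: int_induct[where k = 0])
  case (step1 i)
  then show ?case using assms[of "i + 1"] by simp
next
  case (step2 i)
  then show ?case using assms[of i] by simp
qed simp

subsection \<open>Euler products\<close>

text \<open>The q-Pochhammer symbol (q^2; q^2)_k, with base q^2 as in product formulas written in
  the nome q.\<close>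

definition qpoch :: "complex \<Rightarrow> nat \<Rightarrow> complex" where
  "qpoch q k = (\<Prod>j<k. 1 - q ^ (2 * j + 2))"

definition euler_coeff :: "complex \<Rightarrow> nat \<Rightarrow> complex" where
  "euler_coeff q k = q ^ (k\<^sup>2) / qpoch q k"

text \<open>Euler's expansion of the infinite product of 1 + q^(2n+1) x over n \<ge> 0. Taking the
  power series as the definition gives continuity and the coefficients for convolutions at once; the
  product is recovered in \<open>euler_prod_LIMSEQ\<close>.\<close>

definition euler_prod :: "complex \<Rightarrow> complex \<Rightarrow> complex" where
  "euler_prod q x = (\<Sum>k. euler_coeff q k * x ^ k)"

lemma one_minus_power_nonzero:
  fixes q :: complex
  assumes "norm q < 1" "n > 0"
  shows "1 - q ^ n \<noteq> 0" "1 + q ^ n \<noteq> 0"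
proof -
  have "norm (q ^ n) < 1"
    using assms by (simp add: norm_power power_less_one_iff)
  then have "q ^ n \<noteq> 1" "q ^ n \<noteq> -1" by auto
  then show "1 - q ^ n \<noteq> 0" "1 + q ^ n \<noteq> 0"
    by (auto simp: add_eq_0_iff)
qed

lemma euler_coeff_Suc:
  assumes "norm q < 1"
  shows "euler_coeff q (Suc k) = euler_coeff q k * (q ^ (2 * k + 1) / (1 - q ^ (2 * k + 2)))"
proof -
  have "(Suc k)\<^sup>2 = k\<^sup>2 + (2 * k + 1)" by (simp add: power2_eq_square)
  then show ?thesis
    by (simp add: euler_coeff_def qpoch_def power_add)
qed

text \<open>The functional equation E(x) = (1 + q x) E(q^2 x), read coefficient by
  coefficient.\<close>

lemma euler_coeff_rec:
  assumes "norm q < 1"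
  shows "euler_coeff q (Suc k) = q ^ (2 * Suc k) * euler_coeff q (Suc k) + q ^ (2 * k + 1) * euler_coeff q k"
proof -
  have "1 - q ^ (2 * k + 2) \<noteq> 0"
    using one_minus_power_nonzero[OF assms, of "2 * k + 2"] by simp
  then show ?thesis
    unfolding euler_coeff_Suc[OF assms] by (simp add: field_simps)
qed

text \<open>The ratio of successive coefficients is q^(2k+1) / (1 - q^(2k+2)), which tends to 0, so
  the series is entire in x.\<close>

lemma euler_coeff_summable:
  assumes "norm q < 1"
  shows "summable (\<lambda>k. norm (euler_coeff q k * x ^ k))"
proof -
  define r where "r k = norm x * norm (q ^ (2 * k + 1) / (1 - q ^ (2 * k + 2)))" for k
  have l: "(\<lambda>k. q ^ k) \<longlonglongrightarrow> 0"
    using assms by (rule LIMSEQ_power_zero)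
  have sub: "(\<lambda>k. q ^ (2 * k + c)) \<longlonglongrightarrow> 0" if "c > 0" for c
  proof -
    have "strict_mono (\<lambda>k :: nat. 2 * k + c)" by (auto simp: strict_mono_def)
    from LIMSEQ_subseq_LIMSEQ[OF l this] show ?thesis by (simp add: o_def)
  qed
  have "(\<lambda>k. r k) \<longlonglongrightarrow> norm x * norm (0 / (1 - 0) :: complex)"
    unfolding r_def by (intro tendsto_intros sub) auto
  then have "eventually (\<lambda>k. r k < 1/2) sequentially"
    by (rule order_tendstoD) auto
  then obtain M where M: "\<And>k. k \<ge> M \<Longrightarrow> r k < 1/2"
    by (auto simp: eventually_sequentially)
  have "norm (euler_coeff q (Suc k) * x ^ Suc k) = r k * norm (euler_coeff q k * x ^ k)" for k
    by (simp add: euler_coeff_Suc[OF assms] r_def norm_mult norm_divide norm_power)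
  moreover have "r k * norm (euler_coeff q k * x ^ k) \<le> 1/2 * norm (euler_coeff q k * x ^ k)" if "k \<ge> M" for k
    using M[OF that] by (intro mult_right_mono) auto
  ultimately have "norm (euler_coeff q (Suc k) * x ^ Suc k) \<le> 1/2 * norm (euler_coeff q k * x ^ k)" if "k \<ge> M" for k
    using that by metis
  then show ?thesis
    by (intro summable_ratio_test[where c = "1/2" and N = M]) (simp, simp only: real_norm_def abs_norm_cancel)
qed

lemma isCont_euler_prod: "norm q < 1 \<Longrightarrow> isCont (euler_prod q) x"
  unfolding euler_prod_def[abs_def]
  by (intro isCont_powser_converges_everywhere euler_coeff_summable[THEN summable_norm_cancel])

lemma euler_prod_0: "norm q < 1 \<Longrightarrow> euler_prod q 0 = 1"
  unfolding euler_prod_def powser_zero by (simp add: euler_coeff_def qpoch_def)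

lemma euler_prod_step:
  assumes "norm q < 1"
  shows "euler_prod q x = (1 + q * x) * euler_prod q (q\<^sup>2 * x)"
proof -
  define e where "e = euler_coeff q"
  have S: "summable (\<lambda>k. e k * y ^ k)" for y
    unfolding e_def using euler_coeff_summable[OF assms] by (rule summable_norm_cancel)
  have s: "(\<lambda>k. e k * y ^ k) sums euler_prod q y" for y
    using S by (simp add: euler_prod_def e_def summable_sums)
  have 1: "(\<lambda>k. e (Suc k) * x ^ Suc k) sums (euler_prod q x - e 0)"
    using s[of x] by (subst sums_Suc_iff) simp
  have 2: "(\<lambda>k. e (Suc k) * (q\<^sup>2 * x) ^ Suc k) sums (euler_prod q (q\<^sup>2 * x) - e 0)"
    using s[of "q\<^sup>2 * x"] by (subst sums_Suc_iff) simp
  have 3: "(\<lambda>k. q * x * (e k * (q\<^sup>2 * x) ^ k)) sums (q * x * euler_prod q (q\<^sup>2 * x))"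
    by (intro sums_mult s)
  have "e (Suc k) * x ^ Suc k = e (Suc k) * (q\<^sup>2 * x) ^ Suc k + q * x * (e k * (q\<^sup>2 * x) ^ k)" for k
    unfolding e_def by (subst euler_coeff_rec[OF assms])
      (simp add: algebra_simps power_mult_distrib power_mult[symmetric] flip: power_add)
  then have "(\<lambda>k. e (Suc k) * x ^ Suc k) sums
     ((euler_prod q (q\<^sup>2 * x) - e 0) + q * x * euler_prod q (q\<^sup>2 * x))"
    using sums_add[OF 2 3] by simp
  from sums_unique2[OF 1 this] show ?thesis by (simp add: algebra_simps)
qed

lemma euler_prod_finite:
  assumes "norm q < 1"
  shows "euler_prod q x = (\<Prod>n<N. 1 + q ^ (2 * n + 1) * x) * euler_prod q (q ^ (2 * N) * x)"
proof (induction N)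
  case (Suc N)
  have "euler_prod q (q ^ (2 * N) * x) = (1 + q ^ (2 * N + 1) * x) * euler_prod q (q ^ (2 * Suc N) * x)"
    using euler_prod_step[OF assms, of "q ^ (2 * N) * x"]
    by (simp add: algebra_simps power2_eq_square)
  then show ?case using Suc by simp
qed simp

lemma euler_prod_tail:
  assumes "norm q < 1"
  shows "(\<lambda>N. euler_prod q (q ^ (2 * N) * x)) \<longlonglongrightarrow> 1"
proof -
  have "(\<lambda>N. (q\<^sup>2) ^ N * x) \<longlonglongrightarrow> 0 * x"
    using assms by (intro tendsto_intros LIMSEQ_power_zero) (simp add: norm_power power_less_one_iff)
  then have "(\<lambda>N. q ^ (2 * N) * x) \<longlonglongrightarrow> 0" by (simp add: power_mult)
  from isCont_tendsto_compose[OF isCont_euler_prod[OF assms] this] show ?thesis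
    by (simp add: euler_prod_0[OF assms])
qed

text \<open>After N steps of the functional equation the tail is E(q^(2N) x), which tends to E(0) =
  1; it is eventually nonzero and can be divided out.\<close>

lemma euler_prod_LIMSEQ:
  assumes "norm q < 1"
  shows "(\<lambda>N. \<Prod>n<N. 1 + q ^ (2 * n + 1) * x) \<longlonglongrightarrow> euler_prod q x"
proof -
  have "eventually (\<lambda>N. euler_prod q (q ^ (2 * N) * x) \<noteq> 0) sequentially"
    using euler_prod_tail[OF assms] by (rule tendsto_imp_eventually_ne) simp
  then have "eventually (\<lambda>N. euler_prod q x / euler_prod q (q ^ (2 * N) * x) =
      (\<Prod>n<N. 1 + q ^ (2 * n + 1) * x)) sequentially"
    by eventually_elim (metis euler_prod_finite[OF assms, of x] nonzero_mult_div_cancel_right)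
  moreover have "(\<lambda>N. euler_prod q x / euler_prod q (q ^ (2 * N) * x)) \<longlonglongrightarrow> euler_prod q x / 1"
    by (intro tendsto_intros euler_prod_tail assms) simp
  ultimately show ?thesis
    by (simp add: tendsto_cong)
qed

text \<open>An N with nonzero tail leaves finitely many explicit factors, one of which must vanish.
  The zeros of the theta functions are located from here.\<close>

lemma euler_prod_eq_0D:
  assumes "norm q < 1" "euler_prod q x = 0"
  obtains n where "1 + q ^ (2 * n + 1) * x = 0"
proof -
  have "eventually (\<lambda>N. euler_prod q (q ^ (2 * N) * x) \<noteq> 0) sequentially"
    using euler_prod_tail[OF assms(1)] by (rule tendsto_imp_eventually_ne) simp
  then obtain N where "euler_prod q (q ^ (2 * N) * x) \<noteq> 0"
    by (auto simp: eventually_sequentially)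
  then have "(\<Prod>n<N. 1 + q ^ (2 * n + 1) * x) = 0"
    using euler_prod_finite[OF assms(1), of x N] assms(2) by auto
  then show ?thesis using that by auto
qed

lemma euler_prod_nonzero:
  assumes "norm q < 1" "norm (q * x) < 1"
  shows "euler_prod q x \<noteq> 0"
proof
  assume "euler_prod q x = 0"
  then obtain n where n: "1 + q ^ (2 * n + 1) * x = 0"
    using euler_prod_eq_0D[OF assms(1)] by blast
  have "norm (q ^ (2 * n + 1) * x) = norm q ^ (2 * n) * norm (q * x)"
    by (simp add: norm_mult norm_power)
  also have "\<dots> \<le> 1 * norm (q * x)"
    using assms by (intro mult_right_mono power_le_one) auto
  also have "\<dots> < 1" using assms by simp
  finally have "norm (q ^ (2 * n + 1) * x) < 1" .
  moreover have "q ^ (2 * n + 1) * x = -1"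
    using n by (simp add: add_eq_0_iff)
  ultimately show False by simp
qed

text \<open>E(-q) is the product of the 1 - q^(2n) over n \<ge> 1, the factor of the triple product
  that does not depend on x; it is cancelled several times below.\<close>

lemma euler_prod_minus_nonzero:
  assumes "norm q < 1"
  shows "euler_prod q (- q) \<noteq> 0"
proof (rule euler_prod_nonzero[OF assms])
  have "(norm q)\<^sup>2 < 1" using assms by (simp add: abs_square_less_1)
  then show "norm (q * - q) < 1" by (simp add: norm_mult power2_eq_square)
qed

lemma qpoch_LIMSEQ:
  assumes "norm q < 1"
  shows "qpoch q \<longlonglongrightarrow> euler_prod q (- q)"
proof -
  have "qpoch q = (\<lambda>N. \<Prod>n<N. 1 + q ^ (2 * n + 1) * (- q))"
    by (simp add: qpoch_def fun_eq_iff mult.commute)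
  then show ?thesis
    using euler_prod_LIMSEQ[OF assms, of "- q"] by simp
qed

text \<open>E(q), E(1) and E(-1) are the products of 1 + q^(2n), 1 + q^(2n-1) and 1 - q^(2n-1) over
  n \<ge> 1. Multiplied by the product of the 1 - q^(2n), they reproduce that same product, which
  then cancels.\<close>

lemma euler_identity:
  assumes "norm q < 1"
  shows "euler_prod q q * euler_prod q 1 * euler_prod q (- 1) = 1"
proof -
  note L = euler_prod_LIMSEQ[OF assms]
  \<comment> \<open>Each 1 - q^(2m) with m \<le> 2N splits as (1 - q^m)(1 + q^m); sorting m by
    parity gives four products of N factors. The cut at 2N makes the counts match.\<close>
  have fin: "qpoch q (2 * N) =
    (\<Prod>n<N. 1 + q ^ (2 * n + 1) * q) * (\<Prod>n<N. 1 + q ^ (2 * n + 1) * (- q)) *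
    ((\<Prod>n<N. 1 + q ^ (2 * n + 1) * 1) * (\<Prod>n<N. 1 + q ^ (2 * n + 1) * (- 1)))" for N
  proof (induction N)
    case (Suc N)
    have "(1 - q ^ (2 * (2 * N) + 2)) * (1 - q ^ (2 * (2 * N + 1) + 2)) =
      (1 + q ^ (2 * N + 1) * q) * (1 + q ^ (2 * N + 1) * (- q)) *
      ((1 + q ^ (2 * N + 1) * 1) * (1 + q ^ (2 * N + 1) * (- 1)))"
    proof -
      have "q ^ (2 * (2 * N) + 2) = (q ^ (2 * N + 1))\<^sup>2" "q ^ (2 * (2 * N + 1) + 2) = (q ^ (2 * N + 1) * q)\<^sup>2"
        by (simp_all add: power2_eq_square flip: power_add power_Suc2)
      moreover have "(1 - a\<^sup>2) * (1 - (a * q)\<^sup>2) =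
          (1 + a * q) * (1 + a * (- q)) * ((1 + a * 1) * (1 + a * (- 1)))" for a
        by (simp add: algebra_simps power2_eq_square)
      ultimately show ?thesis by metis
    qed
    moreover have "qpoch q (2 * Suc N) = qpoch q (2 * N) * ((1 - q ^ (2 * (2 * N) + 2)) * (1 - q ^ (2 * (2 * N + 1) + 2)))"
      by (simp add: qpoch_def)
    ultimately show ?case using Suc by (simp only: prod.lessThan_Suc ac_simps)
  qed (simp add: qpoch_def)
  have "strict_mono (\<lambda>N :: nat. 2 * N)" by (auto simp: strict_mono_def)
  from LIMSEQ_subseq_LIMSEQ[OF qpoch_LIMSEQ[OF assms] this]
  have "(\<lambda>N. qpoch q (2 * N)) \<longlonglongrightarrow> euler_prod q (- q)" by (simp add: o_def)
  moreover have "(\<lambda>N. qpoch q (2 * N)) \<longlonglongrightarrow>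
      euler_prod q q * euler_prod q (- q) * (euler_prod q 1 * euler_prod q (- 1))"
    unfolding fin by (intro tendsto_mult L)
  ultimately have "euler_prod q (- q) = euler_prod q q * euler_prod q (- q) * (euler_prod q 1 * euler_prod q (- 1))"
    by (rule LIMSEQ_unique)
  then show ?thesis using euler_prod_minus_nonzero[OF assms] by (simp add: mult.assoc)
qed

subsection \<open>The triple product\<close>

text \<open>Every power q^s, half-integral s included, is \<open>cispi\<close> of \<tau> s.
  Identities between such powers become identities between exponents, and no branch is ever
  chosen.\<close>

definition cispi :: "complex \<Rightarrow> complex" where
  "cispi x = exp (\<i> * of_real pi * x)"

lemma cispi_add: "cispi (x + y) = cispi x * cispi y"
  by (simp add: cispi_def algebra_simps exp_add)

lemma cispi_0 [simp]: "cispi 0 = 1"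
  by (simp add: cispi_def)

lemma cispi_nonzero [simp]: "cispi x \<noteq> 0"
  by (simp add: cispi_def)

lemma cispi_minus: "cispi (- x) = inverse (cispi x)"
  by (simp add: cispi_def exp_minus)

lemma cispi_power: "cispi x ^ n = cispi (of_nat n * x)"
  by (simp add: cispi_def exp_of_nat_mult[symmetric] mult_ac)

lemma norm_cispi: "norm (cispi x) = exp (- (pi * Im x))"
  by (simp add: cispi_def)

lemma norm_cispi_less_1: "Im x > 0 \<Longrightarrow> norm (cispi x) < 1"
  by (simp add: norm_cispi)

lemma cispi_of_int: "cispi (of_int n) = (-1) powi n"
proof -
  have "cispi (of_int n) = cis (pi * of_int n)"
    by (simp add: cispi_def cis_conv_exp mult_ac)
  then show ?thesis using cis_power_int[of pi n] by (simp add: mult_ac)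
qed

lemma cispi_even [simp]: "cispi (2 * of_int n) = 1"
  using cispi_of_int[of "2 * n"] by (simp add: power_int_mult)

lemma summable_exp_quadratic:
  fixes a b :: real
  assumes "a > 0"
  shows "summable (\<lambda>n. exp (- (a * (real n)\<^sup>2) + b * real n))"
proof (rule summable_comparison_test_ev)
  \<comment> \<open>Beyond this threshold a n is at least |b| + 1, which makes the exponent at most
    -n.\<close>
  have "eventually (\<lambda>n. real n \<ge> (\<bar>b\<bar> + 1) / a) sequentially"
    by real_asymp
  then show "eventually (\<lambda>n. norm (exp (- (a * (real n)\<^sup>2) + b * real n)) \<le> exp (- 1) ^ n) sequentially"
  proof eventually_elim
    case (elim n)
    then have "\<bar>b\<bar> + 1 \<le> a * real n"
      using assms by (simp add: field_simps)
    then have "(b + 1) * real n \<le> (a * real n) * real n"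
      by (intro mult_right_mono) auto
    then have "- (a * (real n)\<^sup>2) + b * real n \<le> - real n"
      by (simp add: power2_eq_square algebra_simps)
    then show ?case by (simp add: exp_of_nat_mult[symmetric])
  qed
  show "summable (\<lambda>n. exp (- 1 :: real) ^ n)"
    by (intro summable_geometric) simp
qed

definition theta_term :: "complex \<Rightarrow> complex \<Rightarrow> int \<Rightarrow> complex" where
  "theta_term \<tau> x m = cispi (\<tau> * (of_int m)\<^sup>2 + 2 * of_int m * x)"

text \<open>\<theta>_3 at pi x, as a bilateral series. Up to elementary factors \<theta>_4 and
  \<theta>_2 are its translates by 1/2 and \<tau>/2, so one product formula serves all
  three.\<close>

definition theta :: "complex \<Rightarrow> complex \<Rightarrow> complex" where
  "theta \<tau> x = (\<Sum>\<^sub>\<infinity>m. theta_term \<tau> x m)"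

lemma norm_theta_term:
  "norm (theta_term \<tau> x m) = exp (- (pi * Im \<tau> * (of_int m)\<^sup>2) - 2 * pi * Im x * of_int m)"
proof -
  have "Im (\<tau> * (of_int m)\<^sup>2) = Im \<tau> * (of_int m)\<^sup>2"
    by (simp add: power2_eq_square)
  then show ?thesis
    unfolding theta_term_def norm_cispi by (simp add: algebra_simps)
qed

lemma theta_summable:
  assumes "Im \<tau> > 0"
  shows "theta_term \<tau> x summable_on UNIV"
proof (rule summable_on_intI)
  have a: "pi * Im \<tau> > 0" using assms by simp
  show "summable (\<lambda>n. norm (theta_term \<tau> x (int n)))"
    using summable_exp_quadratic[OF a, of "- 2 * pi * Im x"]
    by (simp add: norm_theta_term algebra_simps)
  have "summable (\<lambda>n. exp (- (pi * Im \<tau> * (real (Suc n))\<^sup>2) + (2 * pi * Im x) * real (Suc n)))"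
    using summable_exp_quadratic[OF a, of "2 * pi * Im x"] by (subst summable_Suc_iff)
  moreover have "norm (theta_term \<tau> x (- int n - 1)) =
      exp (- (pi * Im \<tau> * (real (Suc n))\<^sup>2) + (2 * pi * Im x) * real (Suc n))" for n
    by (simp add: norm_theta_term algebra_simps power2_eq_square)
  ultimately show "summable (\<lambda>n. norm (theta_term \<tau> x (- int n - 1)))"
    by simp
qed

text \<open>Completing the square: \<tau> m^2 + 2mk\<tau> = \<tau> (m + k)^2 - \<tau> k^2, and the
  summation over all integers absorbs the shift of m.\<close>

lemma theta_shift:
  "theta \<tau> (x + of_int k * \<tau>) = cispi (- \<tau> * (of_int k)\<^sup>2 - 2 * of_int k * x) * theta \<tau> x"
proof -
  have "theta_term \<tau> (x + of_int k * \<tau>) m =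
      cispi (- \<tau> * (of_int k)\<^sup>2 - 2 * of_int k * x) * theta_term \<tau> x (m + k)" for m
    unfolding theta_term_def cispi_add[symmetric]
    by (simp add: algebra_simps power2_eq_square)
  then show ?thesis
    using infsum_shift_int(1)[of "theta_term \<tau> x" k]
    by (simp add: theta_def infsum_cmult_right')
qed

text \<open>Extension by 0 makes the recurrence valid at every integer, so sums can be shifted
  without boundary terms.\<close>

definition int_euler_coeff :: "complex \<Rightarrow> int \<Rightarrow> complex" where
  "int_euler_coeff q k = (if k < 0 then 0 else euler_coeff q (nat k))"

section \<open>The product of the Euler products at X and 1/X\<close>

context
  fixes \<tau> q :: complex
  assumes tau: "Im \<tau> > 0" and q_def: "q = cispi \<tau>"
begin

private lemma nq: "norm q < 1"
  using tau by (simp add: q_def norm_cispi_less_1)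

private abbreviation "e \<equiv> int_euler_coeff q"

private lemma e_summable: "(\<lambda>k. e k * cispi (2 * of_int k * x)) summable_on UNIV"
  and e_infsum: "(\<Sum>\<^sub>\<infinity>k. e k * cispi (2 * of_int k * x)) = euler_prod q (cispi (2 * x))"
proof -
  have pos: "e (int n) * cispi (2 * of_int (int n) * x) = euler_coeff q n * cispi (2 * x) ^ n" for n
    by (simp add: int_euler_coeff_def cispi_power mult_ac)
  have neg: "e (- int n - 1) * cispi (2 * of_int (- int n - 1) * x) = 0" for n
    by (simp add: int_euler_coeff_def)
  show S: "(\<lambda>k. e k * cispi (2 * of_int k * x)) summable_on UNIV"
    by (rule summable_on_intI)
      (simp_all only: pos neg euler_coeff_summable[OF nq] norm_zero summable_zero)
  show "(\<Sum>\<^sub>\<infinity>k. e k * cispi (2 * of_int k * x)) = euler_prod q (cispi (2 * x))"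
    unfolding infsum_int_eq_suminf[OF S] pos neg by (simp add: euler_prod_def)
qed

private lemma e_rec:
  "e k = cispi (2 * of_int k * \<tau>) * e k + cispi ((2 * of_int k - 1) * \<tau>) * e (k - 1)"
proof (cases "k \<le> 0")
  case True
  then show ?thesis by (cases "k = 0") (auto simp: int_euler_coeff_def)
next
  case False
  then obtain n where k: "k = int (Suc n)"
    by (metis gr0_conv_Suc linorder_not_le zero_less_imp_eq_int)
  have "cispi (2 * of_int k * \<tau>) = q ^ (2 * Suc n)" "cispi ((2 * of_int k - 1) * \<tau>) = q ^ (2 * n + 1)"
    unfolding q_def cispi_power by (auto simp: k algebra_simps)
  moreover have "e k = euler_coeff q (Suc n)" "e (k - 1) = euler_coeff q n"
    by (auto simp: k int_euler_coeff_def nat_add_distrib)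
  ultimately show ?thesis
    using euler_coeff_rec[OF nq, of n] by simp
qed

text \<open>\<open>B N\<close> is the coefficient of $X^N$ in the product of the Euler products at $X$ and $1/X$.\<close>

private definition "B N = (\<Sum>\<^sub>\<infinity>m. e m * e (m - N))"

private lemma e_shift_summable: "(\<lambda>m. e (m - N) * cispi (2 * of_int (m - N) * x)) summable_on UNIV"
  using e_summable[of x] infsum_shift_int(2)[of "\<lambda>k. e k * cispi (2 * of_int k * x)" "- N"] by simp

text \<open>The recurrence is applied to the factor \<open>e m\<close> on the left and to
  \<open>e (m - (N - 1))\<close> on the right. Both expansions consist of the sums u and v, up to a
  shift of m by one.\<close>

private lemma B_step: "B N = cispi ((2 * of_int N - 1) * \<tau>) * B (N - 1)"
proof -
  define u where "u m = cispi (2 * of_int m * \<tau>) * e m * e (m - N)" for m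
  define v where "v m = cispi ((2 * of_int m - 1) * \<tau>) * e (m - 1) * e (m - N)" for m
  have eN: "(\<lambda>m. e (m - N)) summable_on UNIV"
    using e_shift_summable[of N 0] by simp
  have u: "u summable_on UNIV"
    using summable_on_mult_int[OF e_summable[of \<tau>] eN] by (simp add: u_def[abs_def] mult_ac)
  have "v m = cispi \<tau> * ((e (m - 1) * cispi (2 * of_int (m - 1) * \<tau>)) * e (m - N))" for m
  proof -
    have "cispi ((2 * of_int m - 1) * \<tau>) = cispi \<tau> * cispi (2 * of_int (m - 1) * \<tau>)"
      unfolding cispi_add[symmetric] by (simp add: algebra_simps)
    then show ?thesis by (simp add: v_def mult_ac)
  qed
  moreover have "(\<lambda>m. cispi \<tau> * ((e (m - 1) * cispi (2 * of_int (m - 1) * \<tau>)) * e (m - N))) summable_on UNIV"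
    by (intro summable_on_cmult_right summable_on_mult_int e_shift_summable eN)
  ultimately have v: "v summable_on UNIV" by presburger
  have "e m * e (m - N) = u m + v m" for m
    unfolding u_def v_def by (subst e_rec) (simp add: algebra_simps)
  then have 1: "B N = infsum u UNIV + infsum v UNIV"
    unfolding B_def using infsum_add[OF u v] by simp
  have "cispi ((2 * of_int N - 1) * \<tau>) * (e m * e (m - (N - 1))) = v (m + 1) + u m" for m
  proof -
    have "cispi ((2 * of_int N - 1) * \<tau>) * cispi (2 * of_int (m - (N - 1)) * \<tau>) = cispi ((2 * of_int (m + 1) - 1) * \<tau>)"
      "cispi ((2 * of_int N - 1) * \<tau>) * cispi ((2 * of_int (m - (N - 1)) - 1) * \<tau>) = cispi (2 * of_int m * \<tau>)"
      unfolding cispi_add[symmetric] by (simp_all add: algebra_simps)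
    then show ?thesis
      unfolding u_def v_def by (subst (2) e_rec) (simp add: algebra_simps)
  qed
  then have "cispi ((2 * of_int N - 1) * \<tau>) * B (N - 1) = (\<Sum>\<^sub>\<infinity>m. v (m + 1) + u m)"
    unfolding B_def by (simp add: infsum_cmult_right'[symmetric])
  also have "\<dots> = infsum v UNIV + infsum u UNIV"
    by (subst infsum_add) (use u v infsum_shift_int[of v 1] in auto)
  finally show ?thesis using 1 by simp
qed

private lemma B_eq: "B N = cispi (\<tau> * (of_int N)\<^sup>2) * B 0"
proof -
  have "B N * cispi (- \<tau> * (of_int N)\<^sup>2) = B (N - 1) * cispi (- \<tau> * (of_int (N - 1))\<^sup>2)" for N
  proof -
    have "cispi ((2 * of_int N - 1) * \<tau>) * cispi (- \<tau> * (of_int N)\<^sup>2) = cispi (- \<tau> * (of_int (N - 1))\<^sup>2)"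
      unfolding cispi_add[symmetric] by (simp add: algebra_simps power2_eq_square)
    then show ?thesis by (subst B_step) (simp add: mult_ac)
  qed
  then have "B N * cispi (- \<tau> * (of_int N)\<^sup>2) = B 0 * cispi (- \<tau> * (of_int 0)\<^sup>2)"
    by (rule int_const_of_step)
  then show ?thesis
    by (simp add: cispi_minus field_simps)
qed

text \<open>N is a free parameter: \<open>B 0\<close> is q^(-N^2) B N for each N, and l^2 + (l+N)^2
  - N^2 = 2 l^2 + 2 l N. For large N every term with l > 0 becomes small, so a sum that is opaque at
  N = 0 can be evaluated.\<close>

private lemma B_0_series:
  "B 0 = (\<Sum>l. q ^ (2 * l\<^sup>2 + 2 * l * N) / (qpoch q l * qpoch q (l + N)))"
proof -
  define h where "h l = e l * e (l + int N)" for l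
  have "h summable_on UNIV"
    using summable_on_mult_int[OF e_summable[of 0] e_shift_summable[of "- int N" 0]]
    by (simp add: h_def[abs_def])
  from infsum_int_eq_suminf[OF this]
  have "infsum h UNIV = (\<Sum>n. h (int n))"
    by (simp add: h_def int_euler_coeff_def)
  moreover have "B (int N) = infsum h UNIV"
    unfolding B_def h_def
    using infsum_shift_int(1)[of "\<lambda>m. e m * e (m - int N)" "int N"] by (simp add: mult.commute)
  ultimately have "B 0 = cispi (- \<tau> * (of_nat N)\<^sup>2) * (\<Sum>n. h (int n))"
    using B_eq[of "int N"] by (simp add: cispi_minus field_simps)
  also have "\<dots> = (\<Sum>n. cispi (- \<tau> * (of_nat N)\<^sup>2) * h (int n))"
    using summable_on_int_halves(1)[OF \<open>h summable_on UNIV\<close>]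
    by (intro suminf_mult[symmetric] summable_norm_cancel[of "\<lambda>n. h (int n)"])
  also have "(\<lambda>n. cispi (- \<tau> * (of_nat N)\<^sup>2) * h (int n)) =
      (\<lambda>l. q ^ (2 * l\<^sup>2 + 2 * l * N) / (qpoch q l * qpoch q (l + N)))"
  proof
    fix l
    have "cispi (- \<tau> * (of_nat N)\<^sup>2) * (q ^ (l\<^sup>2) * q ^ ((l + N)\<^sup>2)) = q ^ (2 * l\<^sup>2 + 2 * l * N)"
      unfolding q_def cispi_power cispi_add[symmetric]
      by (simp add: algebra_simps power2_eq_square)
    then show "cispi (- \<tau> * (of_nat N)\<^sup>2) * h (int l) = q ^ (2 * l\<^sup>2 + 2 * l * N) / (qpoch q l * qpoch q (l + N))"
      by (simp add: h_def int_euler_coeff_def euler_coeff_def nat_add_distrib)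
  qed
  finally show ?thesis .
qed

text \<open>As N tends to infinity only l = 0 survives, with the limit of 1 / (q^2; q^2)_N. Because
  l \<le> 2 l^2, a geometric series in |q| dominates uniformly in N and justifies the
  interchange.\<close>

private lemma B_0: "B 0 = 1 / euler_prod q (- q)"
proof -
  define P where "P = euler_prod q (- q)"
  have "P \<noteq> 0"
    unfolding P_def by (rule euler_prod_minus_nonzero[OF nq])
  have inv: "(\<lambda>k. 1 / qpoch q k) \<longlonglongrightarrow> 1 / P"
    unfolding P_def using \<open>P \<noteq> 0\<close> by (intro tendsto_intros qpoch_LIMSEQ nq) (simp add: P_def)
  then have "Bseq (\<lambda>k. 1 / qpoch q k)"
    using convergent_imp_Bseq convergentI by blast
  then obtain K where K: "K > 0" "\<And>k. norm (1 / qpoch q k) \<le> K"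
    unfolding Bseq_def by blast
  define a where "a l N = q ^ (2 * l\<^sup>2 + 2 * l * N) / (qpoch q l * qpoch q (l + N))" for l N
  define b where "b l = (if l = 0 then 1 / P else 0)" for l :: nat
  have lim: "(\<lambda>N. a l N) \<longlonglongrightarrow> b l" for l
  proof (cases "l = 0")
    case True
    then show ?thesis using inv by (simp add: a_def b_def qpoch_def)
  next
    case False
    have "(\<lambda>N. (q ^ (2 * l)) ^ N) \<longlonglongrightarrow> 0"
      using nq False by (intro LIMSEQ_power_zero) (simp add: norm_power power_less_one_iff)
    moreover have "(\<lambda>N. 1 / qpoch q (l + N)) \<longlonglongrightarrow> 1 / P"
      using LIMSEQ_ignore_initial_segment[OF inv, of l] by (simp add: add.commute)
    ultimately have "(\<lambda>N. q ^ (2 * l\<^sup>2) / qpoch q l * (q ^ (2 * l)) ^ N * (1 / qpoch q (l + N))) \<longlonglongrightarrow>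
        q ^ (2 * l\<^sup>2) / qpoch q l * 0 * (1 / P)"
      by (intro tendsto_mult tendsto_const)
    then show ?thesis
      using False by (simp add: a_def b_def power_add power_mult)
  qed
  have bound: "norm (a l N) \<le> K * K * norm q ^ l" for l N
  proof -
    have "norm (a l N) = norm q ^ (2 * l\<^sup>2 + 2 * l * N) * (norm (1 / qpoch q l) * norm (1 / qpoch q (l + N)))"
      by (simp add: a_def norm_divide norm_mult norm_power)
    also have "\<dots> \<le> norm q ^ l * (K * K)"
    proof (intro mult_mono K)
      have "l \<le> 2 * l\<^sup>2 + 2 * l * N"
        by (cases l) (auto simp: power2_eq_square)
      then show "norm q ^ (2 * l\<^sup>2 + 2 * l * N) \<le> norm q ^ l"
        using nq by (intro power_decreasing) auto
    qed (use K(1) in auto)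
    finally show ?thesis by (simp add: mult_ac)
  qed
  have "(\<lambda>N. suminf (\<lambda>l. a l N)) \<longlonglongrightarrow> suminf b"
  proof (rule tannerys_theorem[THEN conjunct2, THEN conjunct2])
    show "eventually (\<lambda>(l, N). norm (a l N) \<le> K * K * norm q ^ l) (at_top \<times>\<^sub>F sequentially)"
      using bound by (intro always_eventually) auto
    show "summable (\<lambda>l. K * K * norm q ^ l)"
      using nq by (intro summable_mult summable_geometric) auto
  qed (use lim in auto)
  moreover have "suminf (\<lambda>l. a l N) = B 0" for N
    unfolding a_def B_0_series[of N] ..
  moreover have "suminf b = 1 / P"
    using sums_single[of 0 "\<lambda>_. 1 / P"] unfolding b_def by (simp add: sums_iff)
  ultimately show ?thesis
    by (simp add: LIMSEQ_const_iff P_def)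
qed

text \<open>With X = cispi (2x), the product of the Euler products at X and 1/X has Laurent
  coefficients q^(N^2) B 0, so it is \<open>B 0\<close> times the theta series; dividing by
  \<open>B 0\<close> brings in E(-q).\<close>

lemma jacobi_triple_product:
  "theta \<tau> x = euler_prod q (- q) * euler_prod q (cispi (2 * x)) * euler_prod q (cispi (- (2 * x)))"
proof -
  define f where "f k = e k * cispi (2 * of_int k * x)" for k
  define g where "g k = e (- k) * cispi (2 * of_int k * x)" for k
  have f: "f summable_on UNIV" "infsum f UNIV = euler_prod q (cispi (2 * x))"
    using e_summable[of x] e_infsum[of x] by (simp_all add: f_def[abs_def])
  define h where "h k = e k * cispi (2 * of_int k * (- x))" for k
  have h: "h summable_on UNIV" "infsum h UNIV = euler_prod q (cispi (- (2 * x)))"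
    using e_summable[of "- x"] e_infsum[of "- x"] by (simp_all add: h_def[abs_def])
  have g_eq: "g = (\<lambda>k. h (- k))"
    by (simp add: g_def h_def fun_eq_iff)
  have g: "g summable_on UNIV" "infsum g UNIV = euler_prod q (cispi (- (2 * x)))"
    using h infsum_uminus_int[of h] by (simp_all add: g_eq)
  have "f m * g (N - m) = cispi (2 * of_int N * x) * (e m * e (m - N))" for m N
  proof -
    have "cispi (2 * of_int m * x) * cispi (2 * of_int (N - m) * x) = cispi (2 * of_int N * x)"
      unfolding cispi_add[symmetric] by (simp add: algebra_simps)
    then show ?thesis by (simp add: f_def g_def mult_ac)
  qed
  then have "(\<Sum>\<^sub>\<infinity>m. f m * g (N - m)) = B 0 * theta_term \<tau> x N" for N
    using B_eq[of N] by (simp add: infsum_cmult_right' B_def theta_term_def cispi_add)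
  then have "((\<lambda>N. B 0 * theta_term \<tau> x N) has_sum (infsum f UNIV * infsum g UNIV)) UNIV"
    using int_convolution(1)[OF f(1) g(1)] by simp
  then have "B 0 * theta \<tau> x = infsum f UNIV * infsum g UNIV"
    unfolding theta_def infsum_cmult_right'[symmetric] by (rule infsumI)
  then show ?thesis
    using euler_prod_minus_nonzero[OF nq] f(2) g(2) by (simp add: B_0 field_simps)
qed

end

subsection \<open>Theta functions\<close>

lemma nome_pow_eq_cispi: "nome_pow \<tau> s = cispi (\<tau> * of_real s)"
  by (simp add: nome_pow_def cispi_def mult_ac)

lemma cos_pi_eq_cispi: "cos (of_real pi * y) = (cispi y + cispi (- y)) / 2"
  by (simp add: cos_exp_eq cispi_def mult_ac)

lemma theta_eq_theta3:
  assumes "Im \<tau> > 0"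
  shows "theta \<tau> x = theta3 \<tau> (of_real pi * x)"
proof -
  let ?t = "theta_term \<tau> x"
  note t = theta_summable[OF assms, of x]
  note h = summable_on_int_halves[OF t, THEN summable_norm_cancel]
  have "theta \<tau> x = (\<Sum>n. ?t (int n)) + (\<Sum>n. ?t (- int n - 1))"
    unfolding theta_def by (rule infsum_int_eq_suminf[OF t])
  \<comment> \<open>Even frequencies pair m with -m, so the term m = 0 stands alone and the
    nonnegative half is moved by one before pairing.\<close>
  also have "(\<Sum>n. ?t (int n)) = 1 + (\<Sum>n. ?t (int (Suc n)))"
    by (subst suminf_split_head[OF h(1)]) (simp add: theta_term_def)
  also have "1 + (\<Sum>n. ?t (int (Suc n))) + (\<Sum>n. ?t (- int n - 1)) =
      1 + (\<Sum>n. ?t (int (Suc n)) + ?t (- int n - 1))"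
    using suminf_add[OF h(1)[THEN summable_Suc_iff[THEN iffD2]] h(2)] by simp
  also have "(\<lambda>n. ?t (int (Suc n)) + ?t (- int n - 1)) =
      (\<lambda>n. 2 * (nome_pow \<tau> ((real (Suc n))\<^sup>2) * cos (of_nat (2 * Suc n) * (of_real pi * x))))"
  proof
    fix n
    have c: "cos (of_nat (2 * Suc n) * (of_real pi * x)) =
        (cispi (of_nat (2 * Suc n) * x) + cispi (- (of_nat (2 * Suc n) * x))) / 2"
      using cos_pi_eq_cispi[of "of_nat (2 * Suc n) * x"] by (simp add: mult_ac)
    have "?t (int (Suc n)) = nome_pow \<tau> ((real (Suc n))\<^sup>2) * cispi (of_nat (2 * Suc n) * x)"
      "?t (- int n - 1) = nome_pow \<tau> ((real (Suc n))\<^sup>2) * cispi (- (of_nat (2 * Suc n) * x))"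
      unfolding theta_term_def nome_pow_eq_cispi cispi_add[symmetric]
      by (simp_all add: algebra_simps power2_eq_square)
    then show "?t (int (Suc n)) + ?t (- int n - 1) =
        2 * (nome_pow \<tau> ((real (Suc n))\<^sup>2) * cos (of_nat (2 * Suc n) * (of_real pi * x)))"
      unfolding c by (simp add: algebra_simps)
  qed
  also have "(\<Sum>n. 2 * (nome_pow \<tau> ((real (Suc n))\<^sup>2) * cos (of_nat (2 * Suc n) * (of_real pi * x)))) =
      2 * (\<Sum>n. nome_pow \<tau> ((real (Suc n))\<^sup>2) * cos (of_nat (2 * Suc n) * (of_real pi * x)))"
  proof (rule suminf_mult)
    have "summable (\<lambda>n. (?t (int (Suc n)) + ?t (- int n - 1)) / 2)"
      using h by (intro summable_divide summable_add h(1)[THEN summable_Suc_iff[THEN iffD2]])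
    then show "summable (\<lambda>n. nome_pow \<tau> ((real (Suc n))\<^sup>2) * cos (of_nat (2 * Suc n) * (of_real pi * x)))"
      unfolding \<open>(\<lambda>n. ?t (int (Suc n)) + ?t (- int n - 1)) = _\<close>[THEN fun_cong] by simp
  qed
  finally show ?thesis
    unfolding theta3_def .
qed

lemma theta_eq_theta4:
  assumes "Im \<tau> > 0"
  shows "theta \<tau> (x + 1/2) = theta4 \<tau> (of_real pi * x)"
proof -
  have "cos (of_nat (2 * Suc n) * (of_real pi * (x + 1/2))) =
      (- 1) ^ Suc n * cos (of_nat (2 * Suc n) * (of_real pi * x))" for n
  proof -
    have e: "of_nat (2 * Suc n) * (of_real pi * (x + 1/2)) =
        of_nat (2 * Suc n) * (of_real pi * x) + of_real (real (Suc n) * pi)"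
      by (simp add: algebra_simps)
    show ?thesis
      unfolding e cos_add by (simp only: cos_of_real sin_of_real cos_npi sin_npi) simp
  qed
  then show ?thesis
    by (simp add: theta_eq_theta3[OF assms] theta3_def theta4_def mult_ac del: power_Suc of_nat_Suc of_nat_mult)
qed

text \<open>The prefactor completes the square: \<tau>/4 + \<tau> m^2 + \<tau> m = \<tau> (m +
  1/2)^2. The terms m and -m-1 then share the square and have opposite frequencies.\<close>

lemma theta_eq_theta2:
  assumes "Im \<tau> > 0"
  shows "cispi (\<tau> / 4 + x) * theta \<tau> (x + \<tau> / 2) = theta2 \<tau> (of_real pi * x)"
proof -
  define t where "t m = cispi (\<tau> / 4 + x) * theta_term \<tau> (x + \<tau> / 2) m" for m
  have S: "t summable_on UNIV"
    unfolding t_def by (intro summable_on_cmult_right theta_summable assms)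
  have t: "t m = cispi (\<tau> * (of_int m + 1/2)\<^sup>2 + (2 * of_int m + 1) * x)" for m
    unfolding t_def theta_term_def cispi_add[symmetric]
    by (simp add: algebra_simps power2_eq_square)
  have "t (int n) + t (- int n - 1) =
      2 * (nome_pow \<tau> ((real n + 1/2)\<^sup>2) * cos (of_nat (2 * n + 1) * (of_real pi * x)))" for n
  proof -
    have c: "cos (of_nat (2 * n + 1) * (of_real pi * x)) =
        (cispi (of_nat (2 * n + 1) * x) + cispi (- (of_nat (2 * n + 1) * x))) / 2"
      using cos_pi_eq_cispi[of "of_nat (2 * n + 1) * x"] by (simp add: mult_ac)
    have "t (int n) = nome_pow \<tau> ((real n + 1/2)\<^sup>2) * cispi (of_nat (2 * n + 1) * x)"
      "t (- int n - 1) = nome_pow \<tau> ((real n + 1/2)\<^sup>2) * cispi (- (of_nat (2 * n + 1) * x))"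
      unfolding t nome_pow_eq_cispi cispi_add[symmetric]
      by (simp_all add: algebra_simps power2_eq_square)
    then show ?thesis
      unfolding c by (simp add: algebra_simps)
  qed
  then have *: "(\<lambda>n. 2 * (nome_pow \<tau> ((real n + 1/2)\<^sup>2) * cos (of_nat (2 * n + 1) * (of_real pi * x)))) sums
      (cispi (\<tau> / 4 + x) * theta \<tau> (x + \<tau> / 2))"
    using int_sums_paired[OF S] by (simp add: t_def[abs_def] infsum_cmult_right' theta_def)
  have "(\<lambda>n. nome_pow \<tau> ((real n + 1/2)\<^sup>2) * cos (of_nat (2 * n + 1) * (of_real pi * x))) sums
      (cispi (\<tau> / 4 + x) * theta \<tau> (x + \<tau> / 2) / 2)"
    using sums_divide[OF *, of 2] by simp
  from sums_unique[OF this] show ?thesis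
    by (simp add: theta2_def)
qed

text \<open>Continuity passes through the triple product, which spares a uniform convergence
  argument for the bilateral series.\<close>

lemma isCont_theta:
  assumes "Im \<tau> > 0"
  shows "isCont (theta \<tau>) x"
proof -
  have *: "isCont (\<lambda>x. euler_prod (cispi \<tau>) (cispi (c * x))) x" for c
    by (rule isCont_o2[OF _ isCont_euler_prod[OF norm_cispi_less_1[OF assms]]])
      (auto simp: cispi_def intro!: continuous_intros)
  have "theta \<tau> = (\<lambda>x. euler_prod (cispi \<tau>) (- cispi \<tau>) * euler_prod (cispi \<tau>) (cispi (2 * x)) *
      euler_prod (cispi \<tau>) (cispi ((- 2) * x)))"
    using jacobi_triple_product[OF assms refl] by (simp add: fun_eq_iff)
  then show ?thesis
    using *[of 2] *[of "- 2"] by (auto intro!: continuous_intros)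
qed

lemma cispi_eq_minus_1D:
  assumes "cispi x = - 1"
  obtains n :: int where "x = 2 * of_int n + 1"
proof -
  have "exp (\<i> * of_real pi * (x - 1)) = 1"
    using assms cispi_of_int[of 1] cispi_add[of "x - 1" 1] by (simp add: cispi_def)
  then obtain n :: int where "Re (\<i> * of_real pi * (x - 1)) = 0" "Im (\<i> * of_real pi * (x - 1)) = of_int (2 * n) * pi"
    by (auto simp: exp_eq_1)
  then have "Im x = 0" "pi * Re x = pi * (2 * of_int n + 1)"
    by (auto simp: algebra_simps)
  then have "x = 2 * of_int n + 1"
    unfolding mult_cancel_left by (simp add: complex_eq_iff)
  then show ?thesis by (rule that)
qed

text \<open>A vanishing factor 1 + q^(2k+1) cispi (2 s x), with s = 1 or s = -1, makes (2k+1) \<tau>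
  + 2 s x an odd integer. The two signs supply the negative and the nonnegative n.\<close>

lemma theta_eq_0D:
  assumes "Im \<tau> > 0" "theta \<tau> x = 0"
  obtains m n :: int where "x = of_int m + 1/2 + (of_int n + 1/2) * \<tau>"
proof -
  define q where "q = cispi \<tau>"
  note nq = norm_cispi_less_1[OF assms(1), folded q_def]
  have "euler_prod q (cispi (2 * x)) = 0 \<or> euler_prod q (cispi (- (2 * x))) = 0"
    using assms(2) euler_prod_minus_nonzero[OF nq] jacobi_triple_product[OF assms(1) q_def] by auto
  then obtain k and s :: int where k: "1 + q ^ (2 * k + 1) * cispi (of_int s * (2 * x)) = 0" and s: "s = 1 \<or> s = - 1"
    by (metis euler_prod_eq_0D[OF nq] mult_1 mult_minus1 of_int_1 of_int_minus)
  have "q ^ (2 * k + 1) * cispi (of_int s * (2 * x)) = cispi (of_nat (2 * k + 1) * \<tau> + of_int s * (2 * x))"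
    unfolding q_def cispi_power cispi_add ..
  with k have "cispi (of_nat (2 * k + 1) * \<tau> + of_int s * (2 * x)) = - 1"
    by (simp add: add_eq_0_iff)
  then obtain l :: int where l: "of_nat (2 * k + 1) * \<tau> + of_int s * (2 * x) = 2 * of_int l + 1"
    by (rule cispi_eq_minus_1D)
  from s show ?thesis
  proof
    assume "s = 1"
    with l have "2 * x = 2 * of_int l + 1 - of_nat (2 * k + 1) * \<tau>"
      by (simp add: algebra_simps)
    then have "x = (2 * of_int l + 1 - of_nat (2 * k + 1) * \<tau>) / 2"
      by (metis nonzero_mult_div_cancel_left zero_neq_numeral)
    also have "\<dots> = of_int l + 1/2 + (of_int (- int k - 1) + 1/2) * \<tau>"
      by (simp add: field_simps)
    finally have "x = of_int l + 1/2 + (of_int (- int k - 1) + 1/2) * \<tau>" .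
    then show ?thesis by (rule that)
  next
    assume "s = - 1"
    with l have "2 * x = of_nat (2 * k + 1) * \<tau> - (2 * of_int l + 1)"
      by (simp add: algebra_simps)
    then have "x = (of_nat (2 * k + 1) * \<tau> - (2 * of_int l + 1)) / 2"
      by (metis nonzero_mult_div_cancel_left zero_neq_numeral)
    also have "\<dots> = of_int (- l - 1) + 1/2 + (of_int (int k) + 1/2) * \<tau>"
      by (simp add: field_simps)
    finally have "x = of_int (- l - 1) + 1/2 + (of_int (int k) + 1/2) * \<tau>" .
    then show ?thesis by (rule that)
  qed
qed

subsection \<open>The Fourier series of cn\<close>

definition cn_coeff :: "complex \<Rightarrow> int \<Rightarrow> complex" where
  "cn_coeff \<tau> n = cispi (\<tau> * (of_int n + 1/2)) / (1 + cispi (\<tau> * (2 * of_int n + 1)))"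

definition cn_term :: "complex \<Rightarrow> complex \<Rightarrow> int \<Rightarrow> complex" where
  "cn_term \<tau> z n = cn_coeff \<tau> n * cispi ((2 * of_int n + 1) * z)"

lemma one_plus_cispi_odd_nonzero:
  assumes "Im \<tau> \<noteq> 0"
  shows "1 + cispi (\<tau> * (2 * of_int n + 1)) \<noteq> 0"
proof
  assume "1 + cispi (\<tau> * (2 * of_int n + 1)) = 0"
  then have "cispi (\<tau> * (2 * of_int n + 1)) = - 1" by (simp add: add_eq_0_iff)
  then obtain l :: int where l: "\<tau> * (2 * of_int n + 1) = 2 * of_int l + 1"
    by (rule cispi_eq_minus_1D)
  from arg_cong[OF l, of Im] have "Im \<tau> * (2 * of_int n + 1) = 0" by simp
  moreover have "2 * of_int n + 1 \<noteq> (0 :: real)"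
  proof -
    have "2 * n + 1 \<noteq> 0" by presburger
    then have "of_int (2 * n + 1) \<noteq> (0 :: real)" by (simp only: of_int_eq_0_iff) simp
    then show ?thesis by simp
  qed
  ultimately show False using assms by simp
qed

text \<open>With p = q^(n+1/2) the coefficient is 1 / (p + 1/p), and n -> -n-1 inverts p.\<close>

lemma cn_coeff_reflect:
  assumes "Im \<tau> \<noteq> 0"
  shows "cn_coeff \<tau> (- n - 1) = cn_coeff \<tau> n"
proof -
  define a where "a = cispi (\<tau> * (2 * of_int n + 1))"
  have a: "a \<noteq> 0" "1 + a \<noteq> 0"
    using one_plus_cispi_odd_nonzero[OF assms] by (auto simp: a_def)
  have 1: "cispi (\<tau> * (2 * of_int (- n - 1) + 1)) = inverse a"
    unfolding a_def cispi_minus[symmetric] by (simp add: algebra_simps)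
  have 2: "cispi (\<tau> * (of_int (- n - 1) + 1/2)) = cispi (\<tau> * (of_int n + 1/2)) / a"
    unfolding a_def divide_inverse cispi_minus[symmetric] cispi_add[symmetric]
    by (simp add: algebra_simps)
  show ?thesis
    unfolding cn_coeff_def 1 2 a_def[symmetric] using a by (simp add: field_simps)
qed

lemma cn_term_reflect:
  assumes "Im \<tau> \<noteq> 0"
  shows "cn_term \<tau> z (- n - 1) = cn_term \<tau> (- z) n"
  unfolding cn_term_def cn_coeff_reflect[OF assms] by (simp add: algebra_simps)

lemma norm_one_plus_cispi_ge:
  assumes "Im \<tau> > 0"
  shows "norm (1 + cispi (\<tau> * (2 * of_nat n + 1))) \<ge> 1 - norm (cispi \<tau>)"
proof -
  have "norm (cispi (\<tau> * (2 * of_nat n + 1))) = norm (cispi \<tau>) ^ (2 * n + 1)"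
    unfolding norm_power[symmetric] cispi_power by (simp add: algebra_simps)
  also have "\<dots> \<le> norm (cispi \<tau>) ^ 1"
    using norm_cispi_less_1[OF assms] by (intro power_decreasing) auto
  finally show ?thesis
    using norm_triangle_ineq4[of "1 + cispi (\<tau> * (2 * of_nat n + 1))" "cispi (\<tau> * (2 * of_nat n + 1))"]
    by simp
qed

lemma norm_cn_term_le:
  assumes "Im \<tau> > 0"
  shows "norm (cn_term \<tau> z (int n)) \<le>
    exp (- (pi * (Im \<tau> / 2 + Im z))) ^ (2 * n + 1) / (1 - norm (cispi \<tau>))"
proof -
  have "norm (cispi (\<tau> * (of_int (int n) + 1/2)) * cispi ((2 * of_int (int n) + 1) * z)) =
      exp (- (pi * (Im \<tau> / 2 + Im z))) ^ (2 * n + 1)"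
    unfolding cispi_add[symmetric] norm_cispi exp_of_nat_mult[symmetric]
    by (simp add: algebra_simps)
  then have "norm (cn_term \<tau> z (int n)) = exp (- (pi * (Im \<tau> / 2 + Im z))) ^ (2 * n + 1) /
      norm (1 + cispi (\<tau> * (2 * of_nat n + 1)))"
    by (simp add: cn_term_def cn_coeff_def norm_divide norm_mult)
  also have "\<dots> \<le> exp (- (pi * (Im \<tau> / 2 + Im z))) ^ (2 * n + 1) / (1 - norm (cispi \<tau>))"
    using norm_cispi_less_1[OF assms]
    by (intro divide_left_mono norm_one_plus_cispi_ge[OF assms] mult_pos_pos
          less_le_trans[OF _ norm_one_plus_cispi_ge[OF assms]]) auto
  finally show ?thesis .
qed

lemma summable_odd_powers:
  fixes r :: real
  assumes "0 \<le> r" "r < 1"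
  shows "summable (\<lambda>n. r ^ (2 * n + 1))"
proof -
  have "r\<^sup>2 < 1" using assms by (simp add: abs_square_less_1)
  then have "summable (\<lambda>n. r * (r\<^sup>2) ^ n)"
    by (intro summable_mult summable_geometric) simp
  then show ?thesis by (simp add: power_mult)
qed

text \<open>The geometric majorant has ratio below 1 once Im z > -Im \<tau>/2. The negative half is
  the same series at -z, whence the strip |Im z| < Im \<tau>/2, that is |\<beta>| < 1/2.\<close>

lemma cn_term_half_summable:
  assumes "Im \<tau> > 0" "- (Im \<tau> / 2) < Im z"
  shows "summable (\<lambda>n. norm (cn_term \<tau> z (int n)))"
proof (rule summable_comparison_test')
  have "0 < pi * (Im \<tau> / 2 + Im z)"
    using assms by (intro mult_pos_pos) auto
  then have "exp (- (pi * (Im \<tau> / 2 + Im z))) < 1" by simp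
  then show "summable (\<lambda>n. exp (- (pi * (Im \<tau> / 2 + Im z))) ^ (2 * n + 1) / (1 - norm (cispi \<tau>)))"
    by (intro summable_divide summable_odd_powers) auto
qed (use norm_cn_term_le[OF assms(1)] in auto)

lemma cn_term_summable:
  assumes "Im \<tau> > 0" "\<bar>Im z\<bar> < Im \<tau> / 2"
  shows "cn_term \<tau> z summable_on UNIV"
  by (rule summable_on_intI)
    (use assms cn_term_half_summable[of \<tau> z] cn_term_half_summable[of \<tau> "- z"] cn_term_reflect[of \<tau> z]
      in auto)

text \<open>The coefficient of e^(pi i z) in the product of \<theta>_4(pi z) with the bilateral
  series. In the notation of the overview it is 2 q^(1/4) C.\<close>

definition cn_theta_const :: "complex \<Rightarrow> complex" where
  "cn_theta_const \<tau> = (\<Sum>\<^sub>\<infinity>m. cispi (\<tau> * (of_int m)\<^sup>2 + of_int m) * cn_coeff \<tau> (- m))"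

text \<open>The solution q^(N^2+N) of the recurrence is q^(-1/4) q^((N+1/2)^2), and this is how the
  coefficients of \<theta>_2 appear.\<close>

lemma cn_series_mult_theta:
  assumes tau: "Im \<tau> > 0" and z: "\<bar>Im z\<bar> < Im \<tau> / 2"
  shows "theta \<tau> (z + 1/2) * (\<Sum>\<^sub>\<infinity>n. cn_term \<tau> z n) =
    cn_theta_const \<tau> * cispi z * theta \<tau> (z + \<tau> / 2)"
proof -
  define a where "a N m = cispi (\<tau> * (of_int m)\<^sup>2 + of_int m) * cn_coeff \<tau> (N - m)" for N m
  define A where "A N = (\<Sum>\<^sub>\<infinity>m. a N m)" for N
  have term_eq: "theta_term \<tau> (w + 1/2) m * cn_term \<tau> w (N - m) =
      cispi ((2 * of_int N + 1) * w) * a N m" for w N m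
  proof -
    have "cispi (\<tau> * (of_int m)\<^sup>2 + 2 * of_int m * (w + 1/2)) * cispi ((2 * of_int (N - m) + 1) * w) =
        cispi ((2 * of_int N + 1) * w) * cispi (\<tau> * (of_int m)\<^sup>2 + of_int m)"
      unfolding cispi_add[symmetric] by (simp add: algebra_simps)
    then show ?thesis
      unfolding theta_term_def cn_term_def a_def by (simp add: mult_ac)
  qed
  have a: "a N summable_on UNIV" for N
    using int_convolution(2)[OF theta_summable[OF tau, of "0 + 1/2"] cn_term_summable[OF tau, of 0], of N]
    unfolding term_eq using tau by simp
  have step: "A N = cispi (2 * of_int N * \<tau>) * A (N - 1)" for N
  proof -
    \<comment> \<open>What remains when the denominators cancel: \<open>a N m\<close> and
      \<open>a (N - 1) (m - 1)\<close> share the coefficient with index N - m, and their combination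
      carries exactly the factor 1 + q^(2(N-m)+1).\<close>
    define w where "w m = cispi (\<tau> * ((of_int m)\<^sup>2 - of_int m + of_int N + 1/2) + of_int m)" for m :: int
    have w: "a N m - cispi (2 * of_int N * \<tau>) * a (N - 1) (m - 1) = w m" for m
    proof -
      have nz: "1 + cispi (\<tau> * (2 * of_int (N - m) + 1)) \<noteq> 0"
        using one_plus_cispi_odd_nonzero[of \<tau> "N - m"] tau by simp
      have "cispi (2 * of_int N * \<tau>) * cispi (\<tau> * (of_int (m - 1))\<^sup>2 + of_int (m - 1)) =
          cispi (\<tau> * (of_int m)\<^sup>2 + of_int m) * cispi (\<tau> * (2 * of_int (N - m) + 1)) * cispi (- 1)"
        unfolding cispi_add[symmetric] by (simp add: algebra_simps power2_eq_square)
      also have "cispi (- 1) = - 1"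
        using cispi_of_int[of "- 1"] by simp
      finally have "a N m - cispi (2 * of_int N * \<tau>) * a (N - 1) (m - 1) =
          cispi (\<tau> * (of_int m)\<^sup>2 + of_int m) * (cn_coeff \<tau> (N - m) * (1 + cispi (\<tau> * (2 * of_int (N - m) + 1))))"
        unfolding a_def by (simp add: algebra_simps)
      also have "cn_coeff \<tau> (N - m) * (1 + cispi (\<tau> * (2 * of_int (N - m) + 1))) = cispi (\<tau> * (of_int (N - m) + 1/2))"
        using nz by (simp add: cn_coeff_def)
      also have "cispi (\<tau> * (of_int m)\<^sup>2 + of_int m) * cispi (\<tau> * (of_int (N - m) + 1/2)) = w m"
        unfolding w_def cispi_add[symmetric] by (simp add: algebra_simps)
      finally show ?thesis .
    qed
    have a1: "(\<lambda>m. cispi (2 * of_int N * \<tau>) * a (N - 1) (m - 1)) summable_on UNIV"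
      using infsum_shift_int(2)[of "a (N - 1)" "- 1"] a[of "N - 1"] by (intro summable_on_cmult_right) simp
    have "infsum w UNIV = A N - cispi (2 * of_int N * \<tau>) * A (N - 1)"
      using infsumI[OF has_sum_add[OF has_sum_infsum[OF a[of N]] has_sum_uminusI[OF has_sum_infsum[OF a1]]]] infsum_shift_int(1)[of "a (N - 1)" "- 1"]
      by (simp add: w A_def infsum_cmult_right')
    moreover have "infsum w UNIV = 0"
    proof -
      \<comment> \<open>The reflection m -> 1 - m fixes m^2 - m and changes the parity of m, so the
        series equals its own negative.\<close>
      have "w (1 - m) = - w m" for m
      proof -
        have "w (1 - m) = w m * cispi (2 * of_int (- m)) * cispi (of_int 1)"
          unfolding w_def cispi_add[symmetric] by (simp add: algebra_simps power2_eq_square)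
        then show ?thesis by (simp only: cispi_even cispi_of_int) simp
      qed
      moreover have "bij_betw (\<lambda>m :: int. 1 - m) UNIV UNIV"
        by (rule bij_betwI[where g = "\<lambda>m. 1 - m"]) auto
      from infsum_reindex_bij_betw[OF this, of w]
      have "(\<Sum>\<^sub>\<infinity>m. w (1 - m)) = infsum w UNIV" .
      ultimately show ?thesis by (simp add: infsum_uminus)
    qed
    ultimately show ?thesis by simp
  qed
  have "A N = cispi (\<tau> * ((of_int N)\<^sup>2 + of_int N)) * A 0" for N
  proof -
    have "A N * cispi (- \<tau> * ((of_int N)\<^sup>2 + of_int N)) =
        A (N - 1) * cispi (- \<tau> * ((of_int (N - 1))\<^sup>2 + of_int (N - 1)))" for N
    proof -
      have "cispi (2 * of_int N * \<tau>) * cispi (- \<tau> * ((of_int N)\<^sup>2 + of_int N)) =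
          cispi (- \<tau> * ((of_int (N - 1))\<^sup>2 + of_int (N - 1)))"
        unfolding cispi_add[symmetric] by (simp add: algebra_simps power2_eq_square)
      then show ?thesis by (subst step) (simp add: mult_ac)
    qed
    then have "A N * cispi (- \<tau> * ((of_int N)\<^sup>2 + of_int N)) =
        A 0 * cispi (- \<tau> * ((of_int 0)\<^sup>2 + of_int 0))"
      by (rule int_const_of_step)
    moreover define p where "p = cispi (\<tau> * ((of_int N)\<^sup>2 + of_int N))"
    moreover have "cispi (- \<tau> * ((of_int N)\<^sup>2 + of_int N)) = inverse p" "p \<noteq> 0"
      unfolding p_def cispi_minus[symmetric] by simp_all
    ultimately have "A N * inverse p = A 0" by simp
    then show ?thesis
      unfolding p_def[symmetric] using \<open>p \<noteq> 0\<close> by (simp add: field_simps)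
  qed
  moreover have "A 0 = cn_theta_const \<tau>"
    by (simp add: A_def a_def cn_theta_const_def)
  moreover have "cispi ((2 * of_int N + 1) * z) * cispi (\<tau> * ((of_int N)\<^sup>2 + of_int N)) =
      cispi z * theta_term \<tau> (z + \<tau> / 2) N" for N
    unfolding theta_term_def cispi_add[symmetric] by (simp add: algebra_simps)
  ultimately have "(\<Sum>\<^sub>\<infinity>m. theta_term \<tau> (z + 1/2) m * cn_term \<tau> z (N - m)) =
      cn_theta_const \<tau> * cispi z * theta_term \<tau> (z + \<tau> / 2) N" for N
    unfolding term_eq infsum_cmult_right' A_def by (simp add: mult_ac)
  then have "((\<lambda>N. cn_theta_const \<tau> * cispi z * theta_term \<tau> (z + \<tau> / 2) N) has_sum
      (theta \<tau> (z + 1/2) * (\<Sum>\<^sub>\<infinity>n. cn_term \<tau> z n))) UNIV"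
    using int_convolution(1)[OF theta_summable[OF tau, of "z + 1/2"] cn_term_summable[OF tau z]]
    by (simp add: theta_def)
  from infsumI[OF this] show ?thesis
    by (simp add: infsum_cmult_right' theta_def)
qed

section \<open>The constant, from the pole on the boundary of the strip\<close>

lemma cispi_imaginary: "cispi (\<i> * of_real t) = of_real (exp (- (pi * t)))"
proof -
  have "\<i> * of_real pi * (\<i> * of_real t) = complex_of_real (- (pi * t))"
    by (simp add: complex_eq_iff)
  then show ?thesis unfolding cispi_def exp_of_real[symmetric] by (rule arg_cong)
qed

text \<open>Near z = \<tau>/2 the nonnegative half stays bounded, while the reflected half is close
  to the sum of the r^(2n+1), which is r / (1 - r^2) with r = exp (-pi s). The factor 1 - r^2
  removes this pole, and r tends to 1.\<close>

lemma cn_series_residue_limit: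
  assumes tau: "Im \<tau> > 0"
  defines "z \<equiv> \<lambda>s :: real. \<tau> / 2 - \<i> * of_real s"
  shows "((\<lambda>s. (1 - of_real (exp (- (2 * pi * s)))) * (\<Sum>\<^sub>\<infinity>n. cn_term \<tau> (z s) n)) \<longlongrightarrow> 1) (at_right 0)"
proof -
  \<comment> \<open>This is |q|^(1/2); its odd powers bound the remainders of both halves uniformly
    in s.\<close>
  define \<rho> where "\<rho> = exp (- (pi * Im \<tau> / 2))"
  define M where "M n = \<rho> ^ (2 * n + 1) / (1 - norm (cispi \<tau>))" for n
  note nq = norm_cispi_less_1[OF tau]
  have \<rho>: "0 \<le> \<rho>" "\<rho> < 1" using tau by (simp_all add: \<rho>_def)
  have M: "summable M"
    unfolding M_def by (intro summable_divide summable_odd_powers \<rho>)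
  define r where "r s = exp (- (pi * s))" for s :: real
  have bound: "norm ((1 - of_real (exp (- (2 * pi * s)))) * (\<Sum>\<^sub>\<infinity>n. cn_term \<tau> (z s) n) - of_real (r s)) \<le>
      (1 - (r s)\<^sup>2) * (2 * suminf M)" if s: "0 < s" "s < Im \<tau> / 2" for s
  proof -
    have r: "0 < r s" "r s < 1" using s by (simp_all add: r_def)
    have R: "exp (- (2 * pi * s)) = (r s)\<^sup>2"
      by (simp add: r_def exp_of_nat_mult[symmetric] algebra_simps)
    have Imz: "Im (z s) = Im \<tau> / 2 - s" by (simp add: z_def)
    have S: "cn_term \<tau> (z s) summable_on UNIV"
      using s by (intro cn_term_summable tau) (auto simp: Imz)
    have b1: "norm (cn_term \<tau> (z s) (int n)) \<le> M n" for n
    proof -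
      have "exp (- (pi * (Im \<tau> / 2 + Im (z s)))) \<le> \<rho>"
        using s by (simp add: \<rho>_def Imz)
      then have "exp (- (pi * (Im \<tau> / 2 + Im (z s)))) ^ (2 * n + 1) \<le> \<rho> ^ (2 * n + 1)"
        by (intro power_mono) auto
      then show ?thesis
        unfolding M_def using nq by (intro order_trans[OF norm_cn_term_le[OF tau]] divide_right_mono) auto
    qed
    \<comment> \<open>The deviation from the geometric term, equal to r^(2n+1) v / (1 + v) with v =
      q^(2n+1); the extra factor v keeps its sum bounded as s tends to 0.\<close>
    define d where "d n = complex_of_real (r s ^ (2 * n + 1)) - cn_term \<tau> (- z s) (int n)" for n
    have b2: "norm (d n) \<le> M n" for n
    proof -
      define v where "v = cispi (\<tau> * (2 * of_nat n + 1))"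
      have nz: "1 + v \<noteq> 0"
        using one_plus_cispi_odd_nonzero[of \<tau> "int n"] tau by (simp add: v_def)
      have "cispi (\<tau> * (of_nat n + 1/2)) * cispi ((2 * of_nat n + 1) * (- z s)) = complex_of_real (r s) ^ (2 * n + 1)"
        unfolding r_def cispi_imaginary[symmetric] cispi_power cispi_add[symmetric]
        by (simp add: z_def algebra_simps)
      then have "cn_term \<tau> (- z s) (int n) = complex_of_real (r s) ^ (2 * n + 1) / (1 + v)"
        by (simp add: cn_term_def cn_coeff_def v_def)
      then have "d n = complex_of_real (r s) ^ (2 * n + 1) * v / (1 + v)"
        using nz by (simp add: d_def field_simps)
      then have "norm (d n) = r s ^ (2 * n + 1) * norm v / norm (1 + v)"
        using r by (simp add: norm_mult norm_divide norm_power)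
      also have "\<dots> \<le> 1 * \<rho> ^ (2 * n + 1) / (1 - norm (cispi \<tau>))"
      proof (intro frac_le mult_mono)
        have "norm v = norm (cispi \<tau>) ^ (2 * n + 1)"
          unfolding norm_power[symmetric] cispi_power v_def by (simp add: algebra_simps)
        also have "\<dots> \<le> \<rho> ^ (2 * n + 1)"
          using tau by (intro power_mono) (auto simp: norm_cispi \<rho>_def)
        finally show "norm v \<le> \<rho> ^ (2 * n + 1)" .
        show "1 - norm (cispi \<tau>) \<le> norm (1 + v)"
          unfolding v_def by (rule norm_one_plus_cispi_ge[OF tau])
        show "r s ^ (2 * n + 1) \<le> 1" using r by (intro power_le_one) auto
      qed (use nq \<rho> in auto)
      finally show ?thesis by (simp add: M_def)
    qed
    have sd: "summable d"
      by (rule summable_comparison_test'[OF M]) (use b2 in auto)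
    have "(\<lambda>n. r s * ((r s)\<^sup>2) ^ n) sums (r s * (1 / (1 - (r s)\<^sup>2)))"
      using r by (intro sums_mult geometric_sums) (simp add: abs_square_less_1)
    then have "(\<lambda>n. r s ^ (2 * n + 1)) sums (r s / (1 - (r s)\<^sup>2))"
      by (simp add: power_mult)
    then have geo: "(\<lambda>n. complex_of_real (r s ^ (2 * n + 1))) sums complex_of_real (r s / (1 - (r s)\<^sup>2))"
      by (rule sums_of_real)
    have "(\<Sum>n. cn_term \<tau> (z s) (- int n - 1)) = (\<Sum>n. complex_of_real (r s ^ (2 * n + 1)) - d n)"
      using tau by (simp add: d_def cn_term_reflect)
    also have "\<dots> = complex_of_real (r s / (1 - (r s)\<^sup>2)) - suminf d"
      using suminf_diff[OF sums_summable[OF geo] sd] sums_unique[OF geo] by simp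
    finally have total: "(\<Sum>\<^sub>\<infinity>n. cn_term \<tau> (z s) n) =
        (\<Sum>n. cn_term \<tau> (z s) (int n)) + (complex_of_real (r s / (1 - (r s)\<^sup>2)) - suminf d)"
      unfolding infsum_int_eq_suminf[OF S] by simp
    have r2: "(r s)\<^sup>2 < 1" using r by (simp add: abs_square_less_1)
    then have "complex_of_real ((1 - (r s)\<^sup>2) * (r s / (1 - (r s)\<^sup>2))) = of_real (r s)"
      by simp
    then have AB: "(1 - complex_of_real ((r s)\<^sup>2)) * complex_of_real (r s / (1 - (r s)\<^sup>2)) = of_real (r s)"
      by (simp only: of_real_mult of_real_diff of_real_1)
    have "A * (S + (B - D)) - A * B = A * (S - D)" for A B S D :: complex
      by (simp add: algebra_simps)
    from this[of "1 - complex_of_real ((r s)\<^sup>2)" _ "complex_of_real (r s / (1 - (r s)\<^sup>2))"]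
    have "(1 - of_real ((r s)\<^sup>2)) * (\<Sum>\<^sub>\<infinity>n. cn_term \<tau> (z s) n) - of_real (r s) =
        complex_of_real (1 - (r s)\<^sup>2) * ((\<Sum>n. cn_term \<tau> (z s) (int n)) - suminf d)"
      unfolding total AB by (simp only: of_real_diff of_real_1)
    also have "norm \<dots> = (1 - (r s)\<^sup>2) * norm ((\<Sum>n. cn_term \<tau> (z s) (int n)) - suminf d)"
      unfolding norm_mult norm_of_real using r2 by simp
    also have "\<dots> \<le> (1 - (r s)\<^sup>2) * (suminf M + suminf M)"
      using r2 b1 b2 M
      by (intro mult_left_mono order_trans[OF norm_triangle_ineq4] add_mono norm_suminf_le) auto
    finally show ?thesis by (simp add: R)
  qed
  have 1: "((\<lambda>s. (1 - of_real (exp (- (2 * pi * s)))) * (\<Sum>\<^sub>\<infinity>n. cn_term \<tau> (z s) n) - of_real (r s)) \<longlongrightarrow> 0) (at_right 0)"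
  proof (rule Lim_null_comparison)
    show "eventually (\<lambda>s. norm ((1 - of_real (exp (- (2 * pi * s)))) * (\<Sum>\<^sub>\<infinity>n. cn_term \<tau> (z s) n) - of_real (r s)) \<le>
        (1 - (r s)\<^sup>2) * (2 * suminf M)) (at_right 0)"
      using eventually_at_right_real[of 0 "Im \<tau> / 2"] tau
      by (auto elim!: eventually_mono intro!: bound)
    have "((\<lambda>s. (1 - (r s)\<^sup>2) * (2 * suminf M)) \<longlongrightarrow> (1 - (exp (- (pi * 0)))\<^sup>2) * (2 * suminf M)) (at_right 0)"
      unfolding r_def by (intro tendsto_intros)
    then show "((\<lambda>s. (1 - (r s)\<^sup>2) * (2 * suminf M)) \<longlongrightarrow> 0) (at_right 0)" by simp
  qed
  have 2: "((\<lambda>s. complex_of_real (r s)) \<longlongrightarrow> complex_of_real (exp (- (pi * 0)))) (at_right 0)"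
    unfolding r_def by (intro tendsto_intros)
  show ?thesis
    using tendsto_add[OF 1 2] by simp
qed

text \<open>Near z = \<tau>/2 the product for \<theta>_4 contains the factor 1 - r^2 that tames the
  series. The limit reads E(-q)^2 q^(1/2) = c E(1)^2, where c is
  \<open>cn_theta_const \<tau>\<close>. With the triple product, the right side of the claim becomes
  2 c times the square of E(q) E(1) E(-1) = 1.\<close>

lemma cn_theta_const_eq:
  assumes tau: "Im \<tau> > 0"
  shows "2 * cn_theta_const \<tau> = cispi (\<tau> / 2) * theta \<tau> (\<tau> / 2) * theta \<tau> (1 / 2)"
proof -
  define q where "q = cispi \<tau>"
  define E where "E = euler_prod q"
  note nq = norm_cispi_less_1[OF tau, folded q_def]
  have q0: "q \<noteq> 0" by (simp add: q_def)
  note triple = jacobi_triple_product[OF tau q_def, folded E_def]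
  note step = euler_prod_step[OF nq, folded E_def]
  define z where "z s = \<tau> / 2 - \<i> * of_real s" for s :: real
  define R where "R s = complex_of_real (exp (- (2 * pi * s)))" for s
  define R' where "R' s = complex_of_real (exp (2 * pi * s))" for s
  have R: "R s = cispi (\<i> * of_real (2 * s))" and R': "R' s = cispi (\<i> * of_real (- 2 * s))" for s
    by (simp_all only: R_def R'_def cispi_imaginary) (simp_all add: mult_ac)
  have theta_z: "theta \<tau> (z s + 1/2) = E (- q) * E (- (q * R' s)) * ((1 - R s) * E (- (q * R s)))" for s
  proof -
    have c: "cispi (2 * (z s + 1/2)) = - (q * R' s)" "cispi (- (2 * (z s + 1/2))) = - (R s / q)"
    proof -
      have "cispi (2 * (z s + 1/2)) = q * R' s * cispi (of_int 1)"
        unfolding q_def R' cispi_add[symmetric] by (simp add: z_def algebra_simps)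
      then show "cispi (2 * (z s + 1/2)) = - (q * R' s)"
        unfolding cispi_of_int by simp
      have "cispi (- (2 * (z s + 1/2))) = inverse q * R s * cispi (of_int (- 1))"
        unfolding q_def R cispi_minus[symmetric] cispi_add[symmetric] by (simp add: z_def algebra_simps)
      then show "cispi (- (2 * (z s + 1/2))) = - (R s / q)"
        unfolding cispi_of_int by (simp add: field_simps)
    qed
    \<comment> \<open>One step of the functional equation exposes the factor that vanishes at s = 0,
      to be attached to the series.\<close>
    have "E (- (R s / q)) = (1 - R s) * E (- (q * R s))"
      using step[of "- (R s / q)"] q0 by (simp add: power2_eq_square)
    then show ?thesis unfolding triple c by simp
  qed
  have eq: "E (- q) * E (- (q * R' s)) * E (- (q * R s)) * ((1 - R s) * (\<Sum>\<^sub>\<infinity>n. cn_term \<tau> (z s) n)) =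
      cn_theta_const \<tau> * cispi (z s) * theta \<tau> (z s + \<tau> / 2)" if "0 < s" "s < Im \<tau>" for s
  proof -
    have "Im (z s) = Im \<tau> / 2 - s" by (simp add: z_def)
    then have "\<bar>Im (z s)\<bar> < Im \<tau> / 2" using that by linarith
    from cn_series_mult_theta[OF tau this] show ?thesis
      unfolding theta_z by (simp only: mult_ac)
  qed
  have E: "((\<lambda>s. E (f s)) \<longlongrightarrow> E l) (at_right 0)" if "(f \<longlongrightarrow> l) (at_right 0)" for f and l :: complex
    unfolding E_def by (rule isCont_tendsto_compose[OF isCont_euler_prod[OF nq] that])
  have "((\<lambda>s. - (q * R' s)) \<longlongrightarrow> - (q * of_real (exp (2 * pi * 0)))) (at_right 0)"
    unfolding R'_def by (intro tendsto_intros)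
  then have lim1: "((\<lambda>s. - (q * R' s)) \<longlongrightarrow> - q) (at_right 0)"
    by (simp only: mult_zero_right exp_zero of_real_1 mult_1_right)
  have "((\<lambda>s. - (q * R s)) \<longlongrightarrow> - (q * of_real (exp (- (2 * pi * 0))))) (at_right 0)"
    unfolding R_def by (intro tendsto_intros)
  then have lim2: "((\<lambda>s. - (q * R s)) \<longlongrightarrow> - q) (at_right 0)"
    by (simp only: mult_zero_right minus_zero exp_zero of_real_1 mult_1_right)
  have L: "((\<lambda>s. E (- q) * E (- (q * R' s)) * E (- (q * R s)) * ((1 - R s) * (\<Sum>\<^sub>\<infinity>n. cn_term \<tau> (z s) n))) \<longlongrightarrow>
      E (- q) * E (- q) * E (- q) * 1) (at_right 0)"
    unfolding R_def z_def
    by (intro tendsto_mult tendsto_const E lim1 lim2[unfolded R_def] cn_series_residue_limit[OF tau])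
  have zlim: "((\<lambda>s. z s) \<longlongrightarrow> \<tau> / 2 - \<i> * of_real 0) (at_right 0)"
    unfolding z_def by (intro tendsto_intros)
  have "((\<lambda>s. cn_theta_const \<tau> * cispi (z s) * theta \<tau> (z s + \<tau> / 2)) \<longlongrightarrow>
      cn_theta_const \<tau> * cispi (\<tau> / 2 - \<i> * of_real 0) * theta \<tau> (\<tau> / 2 - \<i> * of_real 0 + \<tau> / 2)) (at_right 0)"
    using zlim unfolding cispi_def
    by (intro tendsto_intros isCont_tendsto_compose[OF isCont_theta[OF tau]])
  moreover have "eventually (\<lambda>s. cn_theta_const \<tau> * cispi (z s) * theta \<tau> (z s + \<tau> / 2) =
      E (- q) * E (- (q * R' s)) * E (- (q * R s)) * ((1 - R s) * (\<Sum>\<^sub>\<infinity>n. cn_term \<tau> (z s) n))) (at_right 0)"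
    using eventually_at_right_real[OF tau] by eventually_elim (simp add: eq)
  ultimately have "((\<lambda>s. E (- q) * E (- (q * R' s)) * E (- (q * R s)) * ((1 - R s) * (\<Sum>\<^sub>\<infinity>n. cn_term \<tau> (z s) n))) \<longlongrightarrow>
      cn_theta_const \<tau> * cispi (\<tau> / 2) * theta \<tau> \<tau>) (at_right 0)"
    by (subst (asm) tendsto_cong) simp_all
  with L have "E (- q) * E (- q) * E (- q) * 1 = cn_theta_const \<tau> * cispi (\<tau> / 2) * theta \<tau> \<tau>"
    using tendsto_unique trivial_limit_at_right_real by blast
  also have "theta \<tau> \<tau> = cispi (- \<tau>) * (E (- q) * E 1 * E 1)"
    using theta_shift[of \<tau> 0 1] triple[of 0] by simp
  also have "cn_theta_const \<tau> * cispi (\<tau> / 2) * (cispi (- \<tau>) * (E (- q) * E 1 * E 1)) =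
      E (- q) * (cn_theta_const \<tau> * E 1 * E 1 * (cispi (\<tau> / 2) * cispi (- \<tau>)))"
    by (simp only: mult_ac)
  also have "cispi (\<tau> / 2) * cispi (- \<tau>) = inverse (cispi (\<tau> / 2))"
    unfolding cispi_add[symmetric] cispi_minus[symmetric] by simp
  finally have "E (- q) * (E (- q) * E (- q)) = E (- q) * (cn_theta_const \<tau> * E 1 * E 1 * inverse (cispi (\<tau> / 2)))"
    by (simp only: mult_ac mult_1)
  moreover have "E (- q) \<noteq> 0"
    unfolding E_def by (rule euler_prod_minus_nonzero[OF nq])
  ultimately have "E (- q) * E (- q) = cn_theta_const \<tau> * E 1 * E 1 * inverse (cispi (\<tau> / 2))"
    unfolding mult_cancel_left by blast
  then have 1: "E (- q) * E (- q) * cispi (\<tau> / 2) = cn_theta_const \<tau> * E 1 * E 1"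
    by simp
  have "theta \<tau> (\<tau> / 2) = E (- q) * E q * (2 * E q)"
  proof -
    \<comment> \<open>The functional equation at 1/q, where 1 + q x equals 2: the source of the
      factor 2 in \<theta>_2(0).\<close>
    have "E (inverse q) = 2 * E q"
    proof -
      have "q\<^sup>2 * inverse q = q" "q * inverse q = 1" using q0 by (simp_all add: power2_eq_square)
      then show ?thesis using step[of "inverse q"] by simp
    qed
    moreover have "cispi (2 * (\<tau> / 2)) = q" "cispi (- (2 * (\<tau> / 2))) = inverse q"
      unfolding q_def cispi_minus by simp_all
    ultimately show ?thesis unfolding triple by simp
  qed
  moreover have "theta \<tau> (1 / 2) = E (- q) * E (- 1) * E (- 1)"
    unfolding triple using cispi_of_int[of 1] cispi_of_int[of "- 1"] by simp
  ultimately have "cispi (\<tau> / 2) * theta \<tau> (\<tau> / 2) * theta \<tau> (1 / 2) =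
      2 * (E (- q) * E (- q) * cispi (\<tau> / 2)) * (E q * E (- 1)) * (E q * E (- 1))"
    by (simp only: mult_ac)
  also have "\<dots> = 2 * cn_theta_const \<tau> * (E q * E 1 * E (- 1)) * (E q * E 1 * E (- 1))"
    unfolding 1 by (simp only: mult_ac)
  also have "\<dots> = 2 * cn_theta_const \<tau>"
    using euler_identity[OF nq] by (simp add: E_def)
  finally show ?thesis ..
qed

text \<open>Coordinates with respect to 1 and \<tau> are unique, and a zero needs both of them
  half-odd. Excluding one coordinate thus protects a whole line.\<close>

lemma theta_nonzero_real_part:
  assumes "Im \<tau> > 0" "x = of_real a + of_real b * \<tau>"
    and "(\<forall>n :: int. a \<noteq> of_int n + 1/2) \<or> (\<forall>n :: int. b \<noteq> of_int n + 1/2)"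
  shows "theta \<tau> x \<noteq> 0"
proof
  assume "theta \<tau> x = 0"
  then obtain m n :: int where "x = of_int m + 1/2 + (of_int n + 1/2) * \<tau>"
    using theta_eq_0D[OF assms(1)] by blast
  then have e: "of_real a + of_real b * \<tau> = of_int m + 1/2 + (of_int n + 1/2) * \<tau>"
    using assms(2) by simp
  have "b * Im \<tau> = (of_int n + 1/2) * Im \<tau>"
    using arg_cong[OF e, of Im] by simp
  then have b: "b = of_int n + 1/2"
    using assms(1) unfolding mult_cancel_right by simp
  moreover have "a = of_int m + 1/2"
    using arg_cong[OF e, of Re] unfolding b by simp
  ultimately show False using assms(3) by blast
qed

text \<open>Since K k = (pi/2) \<theta>_2^2, the factor in front of \<theta>_2(pi z) / \<theta>_4(pi
  z) is \<theta>_2 \<theta>_4 / 4. The q^(1/2) collects one q^(1/4) from \<theta>_2(0) and one from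
  \<theta>_2(pi z).\<close>

lemma CN_eq_theta:
  assumes tau: "Im \<tau> > 0"
  shows "CN z \<tau> = cispi (\<tau> / 2) * theta \<tau> (\<tau> / 2) * theta \<tau> (1 / 2) / 4 *
    (cispi z * theta \<tau> (z + \<tau> / 2) / theta \<tau> (z + 1/2))"
proof -
  have t3: "theta3 \<tau> 0 \<noteq> 0"
  proof -
    have "theta \<tau> 0 \<noteq> 0"
    proof
      assume "theta \<tau> 0 = 0"
      then obtain m n :: int where e: "0 = of_int m + 1/2 + (of_int n + 1/2) * \<tau>"
        using theta_eq_0D[OF tau] by blast
      from arg_cong[OF e, of Im] have "(of_int n + 1/2) * Im \<tau> = 0" by simp
      then have "of_int (2 * n + 1) = (0 :: real)" using tau by simp
      then show False by (simp only: of_int_eq_0_iff) presburger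
    qed
    then show ?thesis using theta_eq_theta3[OF tau, of 0] by simp
  qed
  then have K: "quarter_K \<tau> \<noteq> 0" by (simp add: quarter_K_def)
  have t4: "theta4 \<tau> 0 = theta \<tau> (1 / 2)" using theta_eq_theta4[OF tau, of 0] by simp
  have t2: "theta2 \<tau> 0 = cispi (\<tau> / 4) * theta \<tau> (\<tau> / 2)" using theta_eq_theta2[OF tau, of 0] by simp
  have t2z: "theta2 \<tau> (of_real pi * z) = cispi (\<tau> / 4) * (cispi z * theta \<tau> (z + \<tau> / 2))"
    unfolding theta_eq_theta2[OF tau, symmetric] by (simp add: cispi_add mult.assoc)
  have "CN z \<tau> = (theta2 \<tau> 0 * theta4 \<tau> 0) / 4 * (theta2 \<tau> (of_real pi * z) / theta4 \<tau> (of_real pi * z))"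
  \<comment> \<open>In the first case both sides are 0, the modulus being 0; so the nonvanishing of
    \<theta>_2(0) never has to be settled.\<close>
  proof (cases "theta2 \<tau> 0 = 0")
    case True
    then show ?thesis by (simp add: CN_def modulus_k_def)
  next
    case False
    have "of_real pi * (2 * quarter_K \<tau> * z / (2 * quarter_K \<tau>)) = of_real pi * z"
      using K by simp
    then show ?thesis
      unfolding CN_def jacobi_cn_def using t3 False
      by (simp add: modulus_k_def quarter_K_def power2_eq_square field_simps)
  qed
  also have "\<dots> = cispi (\<tau> / 4) * cispi (\<tau> / 4) * theta \<tau> (\<tau> / 2) * theta \<tau> (1 / 2) / 4 *
      (cispi z * theta \<tau> (z + \<tau> / 2) / theta \<tau> (z + 1/2))"
    unfolding t2 t4 t2z theta_eq_theta4[OF tau, symmetric] by simp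
  also have "cispi (\<tau> / 4) * cispi (\<tau> / 4) = cispi (\<tau> / 2)"
    unfolding cispi_add[symmetric] by simp
  finally show ?thesis .
qed

text \<open>Zeros of the denominator have Im z = (n + 1/2) Im \<tau>, so none lies in the open strip
  and the convolution identity may be divided. Its constant is twice the prefactor in
  \<open>CN_eq_theta\<close>.\<close>

lemma CN_eq_infsum:
  assumes tau: "Im \<tau> > 0" and z: "\<bar>Im z\<bar> < Im \<tau> / 2"
  shows "CN z \<tau> = (\<Sum>\<^sub>\<infinity>n. cn_term \<tau> z n) / 2"
proof -
  have "theta \<tau> (z + 1/2) \<noteq> 0"
  proof
    assume "theta \<tau> (z + 1/2) = 0"
    then obtain m n :: int where e: "z + 1/2 = of_int m + 1/2 + (of_int n + 1/2) * \<tau>"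
      using theta_eq_0D[OF tau] by blast
    from arg_cong[OF e, of Im] have "Im z = (of_int n + 1/2) * Im \<tau>" by simp
    then have "\<bar>of_int n + 1/2\<bar> * Im \<tau> < 1/2 * Im \<tau>"
      using z tau by (simp add: abs_mult)
    then have "\<bar>of_int n + 1/2 :: real\<bar> < 1/2"
      using tau by (simp only: mult_less_cancel_right_pos)
    then have "real_of_int (- 1) < of_int n" "of_int n < real_of_int 0" unfolding abs_less_iff by simp_all
    then show False unfolding of_int_less_iff by simp
  qed
  then show ?thesis
    using cn_series_mult_theta[OF assms] cn_theta_const_eq[OF tau]
    unfolding CN_eq_theta[OF tau] by (simp add: field_simps)
qed

subsection \<open>Residues\<close>

lemma norm_sin_le_exp: "norm (sin (p :: complex)) \<le> exp \<bar>Im p\<bar>"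
proof -
  have "norm (sin p) = norm (exp (\<i> * p) - exp (- (\<i> * p))) / 2"
    by (simp add: sin_exp_eq norm_divide norm_mult)
  also have "norm (exp (\<i> * p) - exp (- (\<i> * p))) \<le> exp (- Im p) + exp (Im p)"
    using norm_triangle_ineq4[of "exp (\<i> * p)" "exp (- (\<i> * p))"] by simp
  also have "exp (- Im p) + exp (Im p) \<le> 2 * exp \<bar>Im p\<bar>"
    by (cases "Im p \<ge> 0") (simp_all add: exp_le_cancel_iff[THEN iffD2])
  finally show ?thesis by simp
qed

text \<open>With Y = |Im p|, |cos p| is at least (exp Y - exp (-Y)) / 2, and Y \<ge> 1 gives exp
  (-Y) \<le> 1 \<le> exp Y / 2.\<close>

lemma norm_cos_ge_exp:
  assumes "\<bar>Im p\<bar> \<ge> 1"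
  shows "norm (cos (p :: complex)) \<ge> exp \<bar>Im p\<bar> / 4"
proof -
  define Y where "Y = \<bar>Im p\<bar>"
  have Y: "Y \<ge> 1" using assms by (simp add: Y_def)
  have "norm (cos p) = norm (exp (\<i> * p) + exp (- (\<i> * p))) / 2"
    by (simp add: cos_exp_eq norm_divide)
  moreover have "norm (exp (\<i> * p) + exp (- (\<i> * p))) \<ge> exp Y - exp (- Y)"
  proof (cases "Im p \<ge> 0")
    case True
    then show ?thesis
      using norm_diff_ineq[of "exp (- (\<i> * p))" "exp (\<i> * p)"] by (simp add: Y_def add.commute)
  next
    case False
    then show ?thesis
      using norm_diff_ineq[of "exp (\<i> * p)" "exp (- (\<i> * p))"] by (simp add: Y_def)
  qed
  moreover have "exp Y \<ge> 2" "exp (- Y) \<le> 1"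
    using exp_ge_add_one_self[of Y] Y by (linarith, simp)
  ultimately show ?thesis unfolding Y_def[symmetric] by linarith
qed

lemma cos_pi_eq_0_iff: "cos (of_real pi * w) = 0 \<longleftrightarrow> (\<exists>n :: int. w = of_int n + 1/2)" for w :: complex
proof -
  have "of_real pi * w = of_real (of_int n * pi) + of_real pi / 2 \<longleftrightarrow> w = of_int n + 1/2" for n :: int
  proof -
    have "complex_of_real (of_int n * pi) + of_real pi / 2 = of_real pi * (of_int n + 1/2)"
      by (simp add: algebra_simps)
    then show ?thesis by simp
  qed
  then show ?thesis by (simp add: cos_eq_0)
qed

lemma cos_ray_nonzero:
  assumes "Im \<sigma> \<noteq> 0"
  shows "cos (of_real pi * (of_real y * \<sigma>)) \<noteq> 0"
proof
  assume "cos (of_real pi * (of_real y * \<sigma>)) = 0"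
  then obtain n :: int where n: "of_real y * \<sigma> = of_int n + 1/2"
    using cos_pi_eq_0_iff by blast
  from arg_cong[OF n, of Im] have "y = 0" using assms by simp
  with arg_cong[OF n, of Re] have "of_int (2 * n + 1) = (0 :: real)" by simp
  then show False by (simp only: of_int_eq_0_iff) presburger
qed

text \<open>Exponential growth handles large |y| and compactness small |y|: the line meets the real
  axis only at 0, where cos is 1, so it passes through no zero.\<close>

lemma cos_ray_lower_bound:
  assumes "Im \<sigma> \<noteq> 0"
  obtains C where "C > 0" "\<And>y :: real. exp (pi * \<bar>y * Im \<sigma>\<bar>) \<le> C * norm (cos (of_real pi * (of_real y * \<sigma>)))"
proof -
  define b where "b = 1 / (pi * \<bar>Im \<sigma>\<bar>)"
  let ?g = "\<lambda>y :: real. norm (cos (of_real pi * (of_real y * \<sigma>)))"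
  have b: "b > 0" using assms by (simp add: b_def)
  have "continuous_on {- b..b} ?g" by (intro continuous_intros)
  then have "\<exists>x\<in>{- b..b}. \<forall>y\<in>{- b..b}. ?g x \<le> ?g y"
    using b by (intro continuous_attains_inf) auto
  then obtain y0 where y0: "\<And>y. y \<in> {- b..b} \<Longrightarrow> ?g y0 \<le> ?g y"
    by blast
  have g0: "?g y0 > 0" using cos_ray_nonzero[OF assms] by simp
  define C where "C = max 4 (exp 1 / ?g y0)"
  have "exp (pi * \<bar>y * Im \<sigma>\<bar>) \<le> C * ?g y" for y
  proof (cases "pi * \<bar>y * Im \<sigma>\<bar> \<ge> 1")
    case True
    have "Im (of_real pi * (of_real y * \<sigma>)) = pi * (y * Im \<sigma>)" by simp
    then have e: "\<bar>Im (of_real pi * (of_real y * \<sigma>))\<bar> = pi * \<bar>y * Im \<sigma>\<bar>" by (simp add: abs_mult)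
    have "exp (pi * \<bar>y * Im \<sigma>\<bar>) \<le> 4 * ?g y"
      using norm_cos_ge_exp[of "of_real pi * (of_real y * \<sigma>)"] True unfolding e by simp
    also have "\<dots> \<le> C * ?g y" by (intro mult_right_mono) (auto simp: C_def)
    finally show ?thesis .
  next
    case False
    then have "\<bar>y\<bar> * (pi * \<bar>Im \<sigma>\<bar>) \<le> 1" by (simp add: abs_mult mult_ac)
    then have "\<bar>y\<bar> \<le> b" using assms by (simp add: b_def pos_le_divide_eq)
    then have "?g y0 \<le> ?g y" by (intro y0) auto
    have "exp (pi * \<bar>y * Im \<sigma>\<bar>) \<le> exp 1 / ?g y0 * ?g y0" using False g0 by simp
    also have "\<dots> \<le> C * ?g y"
      using \<open>?g y0 \<le> ?g y\<close> g0 by (intro mult_mono) (auto simp: C_def)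
    finally show ?thesis .
  qed
  moreover have "C > 0" by (simp add: C_def)
  ultimately show ?thesis using that by blast
qed

lemma cos_add_nat_pi: "norm (cos (of_real pi * (of_nat N + u))) = norm (cos (of_real pi * u))" for u :: complex
proof -
  have e: "of_real pi * (of_nat N + u) = of_real pi * u + of_real (real N * pi)"
    by (simp add: algebra_simps)
  show ?thesis
    unfolding e cos_add cos_of_real sin_of_real cos_npi sin_npi by (simp add: norm_mult norm_power)
qed

text \<open>On the edge N + y \<sigma> the first cosine is cos (pi y \<sigma>) up to sign and pays
  for the growth of the sine in y, as |A| < 1; the second is at least exp T / 4 with T = pi N |Im
  \<rho>| and beats exp (|B| T). It serves both edges, with \<tau> and 1/\<tau> as \<sigma> and
  \<rho> in either order.\<close>

lemma kernel_side_bound: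
  fixes \<sigma> \<rho> :: complex and A B :: real
  assumes "Im \<sigma> \<noteq> 0" "Im \<rho> \<noteq> 0" "\<bar>A\<bar> < 1" "\<bar>B\<bar> < 1"
  obtains C where "C > 0"
    "\<And>N y p. pi * (real N * \<bar>Im \<rho>\<bar>) \<ge> 1 \<Longrightarrow> Im p = pi * (A * (y * Im \<sigma>) + B * (real N * Im \<rho>)) \<Longrightarrow>
      norm (sin p / (cos (of_real pi * (of_nat N + of_real y * \<sigma>)) * cos (of_real pi * (of_nat N * \<rho> + of_real y))))
        \<le> C * exp (- (pi * (1 - \<bar>B\<bar>) * \<bar>Im \<rho>\<bar>)) ^ N"
proof -
  obtain C where C: "C > 0" "\<And>y :: real. exp (pi * \<bar>y * Im \<sigma>\<bar>) \<le> C * norm (cos (of_real pi * (of_real y * \<sigma>)))"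
    by (rule cos_ray_lower_bound[OF assms(1)]) (rule that)
  have "norm (sin p / (cos (of_real pi * (of_nat N + of_real y * \<sigma>)) * cos (of_real pi * (of_nat N * \<rho> + of_real y))))
      \<le> (4 * C) * exp (- (pi * (1 - \<bar>B\<bar>) * \<bar>Im \<rho>\<bar>)) ^ N"
    if N: "pi * (real N * \<bar>Im \<rho>\<bar>) \<ge> 1" and p: "Im p = pi * (A * (y * Im \<sigma>) + B * (real N * Im \<rho>))"
    for N :: nat and y :: real and p
  proof -
    define c where "c = norm (cos (of_real pi * (of_real y * \<sigma>)))"
    define d where "d = norm (cos (of_real pi * (of_nat N * \<rho> + of_real y)))"
    define S where "S = pi * \<bar>y * Im \<sigma>\<bar>"
    define T where "T = pi * (real N * \<bar>Im \<rho>\<bar>)"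
    have c: "c > 0" using cos_ray_nonzero[OF assms(1)] by (simp add: c_def)
    have cS: "exp S \<le> C * c" unfolding S_def c_def by (rule C)
    have "\<bar>Im (of_real pi * (of_nat N * \<rho> + of_real y))\<bar> = T"
      by (simp add: T_def abs_mult)
    with norm_cos_ge_exp[of "of_real pi * (of_nat N * \<rho> + of_real y)"] N
    have d: "exp T / 4 \<le> d" by (simp add: d_def T_def)
    have "\<bar>Im p\<bar> \<le> S + \<bar>B\<bar> * T"
    proof -
      have "\<bar>Im p\<bar> = pi * \<bar>A * (y * Im \<sigma>) + B * (real N * Im \<rho>)\<bar>" by (simp add: p abs_mult)
      also have "\<dots> \<le> pi * (\<bar>A\<bar> * \<bar>y * Im \<sigma>\<bar> + \<bar>B\<bar> * (real N * \<bar>Im \<rho>\<bar>))"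
        using abs_triangle_ineq[of "A * (y * Im \<sigma>)" "B * (real N * Im \<rho>)"]
        by (intro mult_left_mono) (simp_all add: abs_mult)
      also have "\<dots> \<le> pi * (1 * \<bar>y * Im \<sigma>\<bar> + \<bar>B\<bar> * (real N * \<bar>Im \<rho>\<bar>))"
        using assms by (intro mult_left_mono add_right_mono mult_right_mono) auto
      finally show ?thesis by (simp add: S_def T_def algebra_simps)
    qed
    then have "norm (sin p) \<le> exp (S + \<bar>B\<bar> * T)"
      by (intro order_trans[OF norm_sin_le_exp]) simp
    also have "\<dots> = exp S * exp (\<bar>B\<bar> * T)" by (rule exp_add)
    also have "\<dots> \<le> (C * c) * exp (\<bar>B\<bar> * T)" using cS by (intro mult_right_mono) auto
    finally have "norm (sin p) / (c * d) \<le> C * c * exp (\<bar>B\<bar> * T) / (c * (exp T / 4))"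
      using c d C(1) by (intro frac_le mult_left_mono mult_pos_pos) auto
    also have "\<dots> = 4 * C * (exp (\<bar>B\<bar> * T) / exp T)" using c by (simp add: field_simps)
    also have "exp (\<bar>B\<bar> * T) / exp T = exp (- (pi * (1 - \<bar>B\<bar>) * \<bar>Im \<rho>\<bar>)) ^ N"
      unfolding exp_diff[symmetric] exp_of_nat_mult[symmetric] by (simp add: T_def algebra_simps)
    finally show ?thesis
      by (simp add: norm_divide norm_mult cos_add_nat_pi c_def d_def)
  qed
  then show ?thesis using that[of "4 * C"] C(1) by simp
qed

text \<open>The numerator may vanish at z, as sin (pi w s) can at a zero of a cosine. Writing f as
  (f + 1) - 1 reduces that case to two genuine simple poles.\<close>

lemma residue_quotient_simple_zero:
  assumes "f holomorphic_on s" "g holomorphic_on s" "open s" "connected s" "z \<in> s"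
    and "(g has_field_derivative g') (at z)" "g z = 0" "g' \<noteq> 0"
    and "\<And>w. w \<in> s - {z} \<Longrightarrow> g w \<noteq> 0"
  shows "residue (\<lambda>w. f w / g w) z = f z / g'"
proof (cases "f z = 0")
  case False
  then show ?thesis using assms by (intro residue_simple_pole_deriv)
next
  case True
  have "residue (\<lambda>w. f w / g w) z = residue (\<lambda>w. (f w + 1) / g w - 1 / g w) z"
    by (intro arg_cong2[where f = residue] refl ext) (simp add: diff_divide_distrib[symmetric])
  also have "\<dots> = residue (\<lambda>w. (f w + 1) / g w) z - residue (\<lambda>w. 1 / g w) z"
    using assms by (intro residue_diff[of s]) (auto intro!: holomorphic_intros intro: holomorphic_on_subset)
  also have "residue (\<lambda>w. (f w + 1) / g w) z = (f z + 1) / g'"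
    using assms True by (intro residue_simple_pole_deriv[of "\<lambda>w. f w + 1" s]) (auto intro!: holomorphic_intros)
  also have "residue (\<lambda>w. 1 / g w) z = 1 / g'"
    using assms by (intro residue_simple_pole_deriv[of "\<lambda>w. 1" s]) (auto intro!: holomorphic_intros)
  finally show ?thesis using True by simp
qed

text \<open>The map w -> -w carries the segment to its own reversal, so for odd f the integral is
  its own negative.\<close>

lemma contour_integral_odd_symmetric_line:
  assumes "\<And>w. f (- w) = - f w" "f contour_integrable_on linepath (- a) a"
  shows "contour_integral (linepath (- a) a) f = 0"
proof -
  let ?g = "linepath (- a) a"
  have fi: "(\<lambda>w. f (- w)) contour_integrable_on ?g"
    using contour_integrable_neg[OF assms(2)] by (simp add: assms(1))
  have "uminus \<circ> ?g = reversepath ?g"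
    by (auto simp: linepath_def reversepath_def algebra_simps scaleR_conv_of_real)
  then have "contour_integral (reversepath ?g) f = - contour_integral ?g (\<lambda>w. f (- w))"
    using contour_integral_negatepath[of ?g f] fi by simp
  also have "\<dots> = contour_integral ?g f"
    using contour_integral_neg[of ?g f] by (simp add: assms(1))
  finally have "- contour_integral ?g f = contour_integral ?g f"
    using contour_integral_reversepath[of ?g f] by simp
  then show ?thesis by simp
qed

lemma sin_half_odd_pi: "sin (of_real pi * (of_nat n + 1/2)) = ((- 1) ^ n :: complex)"
proof -
  have e: "of_real pi * (of_nat n + 1/2) = complex_of_real (real n * pi) + of_real (pi / 2)"
    by (simp add: algebra_simps)
  show ?thesis
    unfolding e sin_add cos_of_real sin_of_real cos_npi sin_npi by simp
qed

text \<open>Here e stands for the sign (-1)^n that the derivative of a cosine produces at a pole,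
  and t for the inner derivative, 1 or \<tau>.\<close>

lemma divide_pi_involution:
  fixes S c e t :: complex
  assumes "e * e = 1"
  shows "of_real pi * S / c / (- of_real pi * t * e) = - (e * S / (t * c))"
proof -
  have "inverse e = e" using assms by (metis inverse_unique)
  then show ?thesis by (simp add: divide_inverse mult_ac)
qed

section \<open>Residue sums along the half-axes spanned by 1 and 1/\<tau>\<close>

context
  fixes \<tau> \<tau>' s :: complex and A B :: real
  assumes tau: "Im \<tau> > 0" and tau': "\<tau>' = inverse \<tau>"
    and s_eq: "s = of_real A + of_real B * \<tau>" and A: "\<bar>A\<bar> < 1" and B: "\<bar>B\<bar> < 1"
begin

private lemma tau_nz [simp]: "\<tau> \<noteq> 0" "\<tau>' \<noteq> 0" "\<tau> * \<tau>' = 1" "\<tau>' * \<tau> = 1"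
proof -
  show "\<tau> \<noteq> 0" using tau by auto
  then show "\<tau>' \<noteq> 0" "\<tau> * \<tau>' = 1" "\<tau>' * \<tau> = 1" by (simp_all add: tau')
qed

private lemma Im_tau': "Im \<tau>' < 0"
  using tau by (simp add: tau' divide_less_0_iff sum_power2_gt_zero_iff)

private lemma Im_nz [simp]: "Im \<tau> \<noteq> 0" "Im \<tau>' \<noteq> 0"
  using tau Im_tau' by auto

text \<open>\<open>X w\<close> and \<open>Y w\<close> are the real coordinates of \<open>w = X w + Y w * \<tau>'\<close>; the poles of the kernel lie on the two axes.\<close>

private definition "X w = Im (\<tau> * w) / Im \<tau>"
private definition "Y w = Im w / Im \<tau>'"

private lemma X_coord [simp]: "X (of_real x + of_real y * \<tau>') = x"
  and Y_coord [simp]: "Y (of_real x + of_real y * \<tau>') = y"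
proof -
  have e: "\<tau> * (of_real x + of_real y * \<tau>') = of_real x * \<tau> + of_real y"
    by (simp add: algebra_simps)
  show "X (of_real x + of_real y * \<tau>') = x" "Y (of_real x + of_real y * \<tau>') = y"
    unfolding X_def Y_def e by simp_all
qed

private lemma coord_eq: "w = of_real (X w) + of_real (Y w) * \<tau>'"
proof -
  define v where "v = w - of_real (Y w) * \<tau>'"
  have "Im v = 0" by (simp add: v_def Y_def)
  then obtain x where x: "v = of_real x" by (metis complex_is_Real_iff Reals_cases)
  then have w: "w = of_real x + of_real (Y w) * \<tau>'" by (simp add: v_def algebra_simps)
  have "X w = x" by (subst w) simp
  with w show ?thesis by simp
qed

private lemma X_lin: "X (u *\<^sub>R v + u' *\<^sub>R v') = u * X v + u' * X v'"
  and Y_lin: "Y (u *\<^sub>R v + u' *\<^sub>R v') = u * Y v + u' * Y v'"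
  unfolding X_def Y_def by (simp_all add: algebra_simps add_divide_distrib)

private lemma continuous_XY [continuous_intros]: "continuous_on S X" "continuous_on S Y"
  unfolding X_def Y_def by (intro continuous_intros; simp)+

private definition "k w = of_real pi * sin (of_real pi * w * s) /
   (cos (of_real pi * w) * cos (of_real pi * (\<tau> * w)))"

private lemma cos_pi_zero_coord: "cos (of_real pi * w) = 0 \<longleftrightarrow> Y w = 0 \<and> (\<exists>n :: int. X w = of_int n + 1/2)"
proof
  assume "cos (of_real pi * w) = 0"
  then obtain n :: int where "w = of_int n + 1/2" unfolding cos_pi_eq_0_iff by blast
  then have "w = of_real (of_int n + 1/2) + of_real 0 * \<tau>'" by simp
  then have "X w = of_int n + 1/2" "Y w = 0"
    using X_coord Y_coord by metis+
  then show "Y w = 0 \<and> (\<exists>n :: int. X w = of_int n + 1/2)" by blast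
next
  assume "Y w = 0 \<and> (\<exists>n :: int. X w = of_int n + 1/2)"
  then obtain n :: int where "X w = of_int n + 1/2" "Y w = 0" by blast
  then have "w = of_int n + 1/2" using coord_eq[of w] by simp
  then show "cos (of_real pi * w) = 0" unfolding cos_pi_eq_0_iff by blast
qed

private lemma cos_pi_tau_zero_coord:
  "cos (of_real pi * (\<tau> * w)) = 0 \<longleftrightarrow> X w = 0 \<and> (\<exists>n :: int. Y w = of_int n + 1/2)"
proof
  assume "cos (of_real pi * (\<tau> * w)) = 0"
  then obtain n :: int where n: "\<tau> * w = of_int n + 1/2" unfolding cos_pi_eq_0_iff by blast
  have "w = \<tau>' * (\<tau> * w)" by (simp add: mult.assoc[symmetric])
  then have "w = of_real 0 + of_real (of_int n + 1/2) * \<tau>'" unfolding n by simp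
  then have "X w = 0" "Y w = of_int n + 1/2"
    using X_coord Y_coord by metis+
  then show "X w = 0 \<and> (\<exists>n :: int. Y w = of_int n + 1/2)" by blast
next
  assume "X w = 0 \<and> (\<exists>n :: int. Y w = of_int n + 1/2)"
  then obtain n :: int where "X w = 0" "Y w = of_int n + 1/2" by blast
  then have "\<tau> * w = (of_int n + 1/2) * (\<tau> * \<tau>')" using coord_eq[of w] by (simp add: mult_ac)
  then have "\<tau> * w = of_int n + 1/2" by simp
  then show "cos (of_real pi * (\<tau> * w)) = 0" unfolding cos_pi_eq_0_iff by blast
qed

private lemma k_holomorphic:
  assumes "\<And>w. w \<in> S \<Longrightarrow> cos (of_real pi * w) \<noteq> 0 \<and> cos (of_real pi * (\<tau> * w)) \<noteq> 0"
  shows "k holomorphic_on S"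
  unfolding k_def by (intro holomorphic_intros) (use assms in auto)

text \<open>Minus the residue at n + 1/2; the sign anticipates the clockwise contour. For s = 2z - 1
  it is minus the n-th term of the cosine series.\<close>

private definition "r1 n = (- 1) ^ n * sin ((of_nat n + 1/2) * of_real pi * s) /
  cos ((of_nat n + 1/2) * of_real pi * \<tau>)"

private definition "r2 n = (- 1) ^ n * sin ((of_nat n + 1/2) * of_real pi * s / \<tau>) /
  (\<tau> * cos ((of_nat n + 1/2) * of_real pi / \<tau>))"

text \<open>Strips of width one are convex neighbourhoods that isolate a single pole, as the residue
  formula requires.\<close>

private lemma strip_X: "open {w. c < X w \<and> X w < d}" "connected {w. c < X w \<and> X w < d}"
  and strip_Y: "open {w. c < Y w \<and> Y w < d}" "connected {w. c < Y w \<and> Y w < d}"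
proof -
  show "open {w. c < X w \<and> X w < d}" "open {w. c < Y w \<and> Y w < d}"
    by (intro open_Collect_conj open_Collect_less continuous_intros)+
  have lt: "c < u * x + v * y" if "c < x" "c < y" "0 \<le> u" "0 \<le> v" "u + v = 1" for x y u v :: real
    using convex_bound_lt[of "- x" "- c" "- y" u v] that by simp
  show "connected {w. c < X w \<and> X w < d}" "connected {w. c < Y w \<and> Y w < d}"
    by (auto intro!: convex_connected convexI convex_bound_lt lt simp: X_lin Y_lin)
qed

private lemma residue_k_real: "residue k (of_nat n + 1/2) = - r1 n"
proof -
  let ?p = "of_nat n + 1/2 :: complex"
  \<comment> \<open>Since n \<ge> 0 this strip avoids the other axis, where X = 0, and n + 1/2 is
    the only half-odd value inside it.\<close>
  define S where "S = {w. real n < X w \<and> X w < real n + 1}"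
  have p: "?p = of_real (real n + 1/2) + of_real 0 * \<tau>'" by simp
  have Xp: "X ?p = real n + 1/2" "Y ?p = 0" unfolding p X_coord Y_coord by simp_all
  have nz: "cos (of_real pi * (\<tau> * w)) \<noteq> 0" if "w \<in> S" for w
    using that unfolding cos_pi_tau_zero_coord S_def by auto
  have "residue (\<lambda>w. (of_real pi * sin (of_real pi * w * s) / cos (of_real pi * (\<tau> * w))) / cos (of_real pi * w)) ?p =
      (of_real pi * sin (of_real pi * ?p * s) / cos (of_real pi * (\<tau> * ?p))) / (- of_real pi * sin (of_real pi * ?p))"
  proof (rule residue_quotient_simple_zero[where s = S])
    show "(\<lambda>w. of_real pi * sin (of_real pi * w * s) / cos (of_real pi * (\<tau> * w))) holomorphic_on S"
      using nz by (intro holomorphic_intros) auto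
    show "((\<lambda>w. cos (of_real pi * w)) has_field_derivative - of_real pi * sin (of_real pi * ?p)) (at ?p)"
      by (auto intro!: derivative_eq_intros)
    show "cos (of_real pi * ?p) = 0"
      unfolding cos_pi_eq_0_iff by (rule exI[of _ "int n"]) simp
    show "- of_real pi * sin (of_real pi * ?p) \<noteq> 0"
      unfolding sin_half_odd_pi by simp
    show "open S" "connected S" unfolding S_def by (rule strip_X)+
    show "?p \<in> S" using Xp by (simp add: S_def)
    show "cos (of_real pi * w) \<noteq> 0" if w: "w \<in> S - {?p}" for w
    proof
      assume "cos (of_real pi * w) = 0"
      then obtain m :: int where m: "Y w = 0" "X w = of_int m + 1/2" unfolding cos_pi_zero_coord by blast
      with w have "real n < of_int m + 1/2" "of_int m + 1/2 < real n + 1" by (auto simp: S_def)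
      then have "m = int n" by linarith
      then have "w = ?p" using coord_eq[of w] coord_eq[of ?p] m Xp by simp
      with w show False by simp
    qed
  qed (auto intro!: holomorphic_intros)
  also have "\<dots> = - r1 n"
  proof -
    have e: "of_real pi * ?p * s = ?p * of_real pi * s" "of_real pi * (\<tau> * ?p) = ?p * of_real pi * \<tau>"
      by (simp_all only: mult_ac)
    have "(- 1) ^ n * (- 1) ^ n = (1 :: complex)" by (simp flip: power_mult_distrib)
    from divide_pi_involution[OF this, where t = 1] show ?thesis
      unfolding sin_half_odd_pi r1_def e by simp
  qed
  finally show ?thesis by (simp add: k_def[abs_def] mult_ac)
qed

private lemma residue_k_tau: "residue k ((of_nat n + 1/2) * \<tau>') = - r2 n"
proof -
  let ?p = "(of_nat n + 1/2) * \<tau>' :: complex"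
  define S where "S = {w. real n < Y w \<and> Y w < real n + 1}"
  have p: "?p = of_real 0 + of_real (real n + 1/2) * \<tau>'" by simp
  have Xp: "X ?p = 0" "Y ?p = real n + 1/2" unfolding p X_coord Y_coord by simp_all
  have tp: "\<tau> * ?p = of_nat n + 1/2"
  proof -
    have "\<tau> * ?p = (of_nat n + 1/2) * (\<tau> * \<tau>')" by (simp only: mult_ac)
    then show ?thesis by simp
  qed
  have nz: "cos (of_real pi * w) \<noteq> 0" if "w \<in> S" for w
    using that unfolding cos_pi_zero_coord S_def by auto
  have "residue (\<lambda>w. (of_real pi * sin (of_real pi * w * s) / cos (of_real pi * w)) / cos (of_real pi * (\<tau> * w))) ?p =
      (of_real pi * sin (of_real pi * ?p * s) / cos (of_real pi * ?p)) / (- of_real pi * \<tau> * sin (of_real pi * (\<tau> * ?p)))"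
  proof (rule residue_quotient_simple_zero[where s = S])
    show "(\<lambda>w. of_real pi * sin (of_real pi * w * s) / cos (of_real pi * w)) holomorphic_on S"
      using nz by (intro holomorphic_intros) auto
    show "((\<lambda>w. cos (of_real pi * (\<tau> * w))) has_field_derivative - of_real pi * \<tau> * sin (of_real pi * (\<tau> * ?p))) (at ?p)"
      by (auto intro!: derivative_eq_intros)
    show "cos (of_real pi * (\<tau> * ?p)) = 0"
      unfolding tp cos_pi_eq_0_iff by (rule exI[of _ "int n"]) simp
    show "- of_real pi * \<tau> * sin (of_real pi * (\<tau> * ?p)) \<noteq> 0"
      unfolding tp sin_half_odd_pi by simp
    show "open S" "connected S" unfolding S_def by (rule strip_Y)+
    show "?p \<in> S" using Xp by (simp add: S_def)
    show "cos (of_real pi * (\<tau> * w)) \<noteq> 0" if w: "w \<in> S - {?p}" for w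
    proof
      assume "cos (of_real pi * (\<tau> * w)) = 0"
      then obtain m :: int where m: "X w = 0" "Y w = of_int m + 1/2" unfolding cos_pi_tau_zero_coord by blast
      with w have "real n < of_int m + 1/2" "of_int m + 1/2 < real n + 1" by (auto simp: S_def)
      then have "m = int n" by linarith
      then have "w = ?p" using coord_eq[of w] coord_eq[of ?p] m Xp by simp
      with w show False by simp
    qed
  qed (auto intro!: holomorphic_intros)
  also have "\<dots> = - r2 n"
  proof -
    have e: "of_real pi * ?p * s = (of_nat n + 1/2) * of_real pi * s / \<tau>"
      "of_real pi * ?p = (of_nat n + 1/2) * of_real pi / \<tau>"
      unfolding tau' divide_inverse by (simp_all only: mult_ac)
    have "(- 1) ^ n * (- 1) ^ n = (1 :: complex)" by (simp flip: power_mult_distrib)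
    from divide_pi_involution[OF this, where t = \<tau>] show ?thesis
      unfolding tp sin_half_odd_pi r2_def e(1) unfolding e(2) .
  qed
  finally show ?thesis by (simp add: k_def[abs_def] mult_ac)
qed

text \<open>With x and y equal to 1 or -1, the edges cross the axes at integers, midway between
  half-odd poles.\<close>

private definition "vtx N x y = of_real (real N * x) + of_real (real N * y) * \<tau>'" for N and x y :: real

private lemma segment_coord:
  assumes "w \<in> closed_segment (vtx N x y) (vtx N x' y')"
  obtains u where "0 \<le> u" "u \<le> 1" "X w = real N * ((1 - u) * x + u * x')" "Y w = real N * ((1 - u) * y + u * y')"
proof -
  obtain u where u: "0 \<le> u" "u \<le> 1" "w = (1 - u) *\<^sub>R vtx N x y + u *\<^sub>R vtx N x' y'"
    using assms by (auto simp: closed_segment_def)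
  have "X w = real N * ((1 - u) * x + u * x')" "Y w = real N * ((1 - u) * y + u * y')"
    unfolding u(3) X_lin Y_lin vtx_def X_coord Y_coord by (simp_all add: algebra_simps)
  then show ?thesis using that u by blast
qed

text \<open>
  The triangle covers one half of each axis; its edge through the origin does not contribute, the
  kernel being odd.
\<close>

private definition "tri N = linepath (vtx N 1 (- 1)) (vtx N 1 1) +++
  linepath (vtx N 1 1) (vtx N (- 1) 1) +++ linepath (vtx N (- 1) 1) (vtx N 1 (- 1))"

text \<open>The corners run counterclockwise in the coordinates (X, Y), but Im (1/\<tau>) < 0 makes
  the basis 1, 1/\<tau> negatively oriented; hence the value -1.\<close>

private lemma winding_tri:
  assumes "X w < real N" "Y w < real N" "X w + Y w > 0"
  shows "winding_number (tri N) w = - 1"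
proof -
  have N: "real N > 0" using assms by linarith
  define T where "T = {w. X w < real N \<and> Y w < real N \<and> 0 < X w + Y w}"
  have "T \<subseteq> convex hull {vtx N 1 (- 1), vtx N 1 1, vtx N (- 1) 1}"
  proof
    fix v assume v: "v \<in> T"
    \<comment> \<open>Barycentric coordinates a, b, c with respect to the three corners, in the
      order of the path.\<close>
    define a where "a = (real N - Y v) / (2 * real N)"
    define b where "b = (X v + Y v) / (2 * real N)"
    define c where "c = (real N - X v) / (2 * real N)"
    have pos: "0 \<le> a" "0 \<le> b" "0 \<le> c" using v N by (auto simp: a_def b_def c_def T_def)
    have sum: "a + b + c = 1"
      using N by (simp add: a_def b_def c_def add_divide_distrib[symmetric])
    have x: "real N * a + real N * b - real N * c = X v" "real N * b + real N * c - real N * a = Y v"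
      using N by (simp_all add: a_def b_def c_def field_simps)
    have "a *\<^sub>R vtx N 1 (- 1) + b *\<^sub>R vtx N 1 1 + c *\<^sub>R vtx N (- 1) 1 =
        of_real (real N * a + real N * b - real N * c) + of_real (real N * b + real N * c - real N * a) * \<tau>'"
      by (simp add: vtx_def scaleR_conv_of_real algebra_simps)
    also have "\<dots> = v" unfolding x by (rule coord_eq[symmetric])
    finally show "v \<in> convex hull {vtx N 1 (- 1), vtx N 1 1, vtx N (- 1) 1}"
      unfolding convex_hull_3 using pos sum by blast
  qed
  moreover have "open T"
    unfolding T_def by (intro open_Collect_conj open_Collect_less continuous_intros)
  moreover have "w \<in> T" using assms by (simp add: T_def)
  ultimately have "w \<in> interior (convex hull {vtx N 1 (- 1), vtx N 1 1, vtx N (- 1) 1})"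
    using interior_maximal by blast
  from winding_number_triangle[OF this]
  have wn: "winding_number (tri N) w =
    (if 0 < Im ((vtx N 1 1 - vtx N 1 (- 1)) * cnj (vtx N 1 1 - w)) then 1 else - 1)"
    by (simp add: tri_def)
  have d: "vtx N 1 1 - w = of_real (real N - X w) + of_real (real N - Y w) * \<tau>'"
  proof -
    have "vtx N 1 1 - (of_real x + of_real y * \<tau>') = of_real (real N - x) + of_real (real N - y) * \<tau>'" for x y
      by (simp add: vtx_def algebra_simps)
    from this[of "X w" "Y w"] show ?thesis unfolding coord_eq[symmetric] .
  qed
  have "vtx N 1 1 - vtx N 1 (- 1) = of_real (2 * real N) * \<tau>'"
    by (simp add: vtx_def algebra_simps)
  then have "Im ((vtx N 1 1 - vtx N 1 (- 1)) * cnj (vtx N 1 1 - w)) = 2 * real N * (real N - X w) * Im \<tau>'"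
    unfolding d by (simp add: algebra_simps)
  also have "\<dots> < 0" using N assms Im_tau' by (intro mult_pos_neg mult_pos_pos) auto
  finally show ?thesis unfolding wn by simp
qed

private definition "pts N = (\<lambda>n. of_nat n + 1/2) ` {..<N} \<union> (\<lambda>n. (of_nat n + 1/2) * \<tau>') ` {..<N}"

private lemma pts_coord:
  assumes "p \<in> pts N"
  shows "(\<exists>n<N. X p = real n + 1/2 \<and> Y p = 0) \<or> (\<exists>n<N. X p = 0 \<and> Y p = real n + 1/2)"
proof -
  have "X (of_nat n + 1/2) = real n + 1/2 \<and> Y (of_nat n + 1/2) = 0" for n
    using X_coord[of "real n + 1/2" 0] Y_coord[of "real n + 1/2" 0] by simp
  moreover have "X ((of_nat n + 1/2) * \<tau>') = 0 \<and> Y ((of_nat n + 1/2) * \<tau>') = real n + 1/2" for n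
    using X_coord[of 0 "real n + 1/2"] Y_coord[of 0 "real n + 1/2"] by simp
  ultimately show ?thesis using assms by (auto simp: pts_def)
qed

text \<open>The triangle enlarged by 1/4: it contains the contour and stops short of the next poles,
  at N + 1/2 and -1/2 on either axis.\<close>

private definition "region N = {w. X w < real N + 1/4 \<and> Y w < real N + 1/4 \<and> - 1/4 < X w + Y w}"

private lemma region_props: "open (region N)" "convex (region N)"
proof -
  show "open (region N)"
    unfolding region_def by (intro open_Collect_conj open_Collect_less continuous_intros)
  show "convex (region N)"
  proof (rule convexI)
    fix v v' u u' assume v: "v \<in> region N" "v' \<in> region N" "0 \<le> (u :: real)" "0 \<le> u'" "u + u' = 1"
    have "u * X v + u' * X v' < real N + 1/4" "u * Y v + u' * Y v' < real N + 1/4"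
      "u * (- X v - Y v) + u' * (- X v' - Y v') < 1/4"
      using v by (intro convex_bound_lt; simp add: region_def)+
    then show "u *\<^sub>R v + u' *\<^sub>R v' \<in> region N"
      unfolding region_def by (simp add: X_lin Y_lin algebra_simps)
  qed
qed

private lemma k_holomorphic_region: "k holomorphic_on region N - pts N"
proof (rule k_holomorphic)
  fix w assume w: "w \<in> region N - pts N"
  have "cos (of_real pi * w) \<noteq> 0"
  proof
    assume "cos (of_real pi * w) = 0"
    then obtain m :: int where m: "Y w = 0" "X w = of_int m + 1/2" unfolding cos_pi_zero_coord by blast
    with w have "of_int m + 1/2 < real N + 1/4" "- 1/4 < of_int m + (1/2 :: real)" by (auto simp: region_def)
    then have "m < int N" "m \<ge> 0" by linarith+
    then obtain n where n: "m = int n" "n < N" by (metis nonneg_int_cases of_nat_less_iff)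
    then have "w = of_nat n + 1/2" using coord_eq[of w] m by simp
    with n w show False by (auto simp: pts_def)
  qed
  moreover have "cos (of_real pi * (\<tau> * w)) \<noteq> 0"
  proof
    assume "cos (of_real pi * (\<tau> * w)) = 0"
    then obtain m :: int where m: "X w = 0" "Y w = of_int m + 1/2" unfolding cos_pi_tau_zero_coord by blast
    with w have "of_int m + 1/2 < real N + 1/4" "- 1/4 < of_int m + (1/2 :: real)" by (auto simp: region_def)
    then have "m < int N" "m \<ge> 0" by linarith+
    then obtain n where n: "m = int n" "n < N" by (metis nonneg_int_cases of_nat_less_iff)
    then have "w = (of_nat n + 1/2) * \<tau>'" using coord_eq[of w] m by simp
    with n w show False by (auto simp: pts_def)
  qed
  ultimately show "cos (of_real pi * w) \<noteq> 0 \<and> cos (of_real pi * (\<tau> * w)) \<noteq> 0" by blast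
qed

private lemma edge_avoids:
  assumes "N > 0"
  shows "closed_segment (vtx N 1 (- 1)) (vtx N 1 1) \<subseteq> region N - pts N"
    "closed_segment (vtx N 1 1) (vtx N (- 1) 1) \<subseteq> region N - pts N"
    "closed_segment (vtx N (- 1) 1) (vtx N 1 (- 1)) \<subseteq> region N - pts N"
proof -
  \<comment> \<open>On the contour X = N, Y = N or X + Y = 0, while a point of \<open>pts N\<close>
    has one coordinate 0 and the other strictly between 0 and N.\<close>
  have avoid: "w \<in> region N - pts N"
    if "X w \<le> real N" "Y w \<le> real N" "0 \<le> X w + Y w" "X w = real N \<or> Y w = real N \<or> X w + Y w = 0" for w
  proof -
    have "w \<notin> pts N"
    proof
      assume "w \<in> pts N"
      from pts_coord[OF this] show False
      proof (elim disjE exE conjE)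
        fix n assume "n < N" "X w = real n + 1/2" "Y w = 0"
        with that assms show False by linarith
      next
        fix n assume "n < N" "X w = 0" "Y w = real n + 1/2"
        with that assms show False by linarith
      qed
    qed
    then show ?thesis using that by (simp add: region_def)
  qed
  have Nm: "real N * t \<le> real N" "- real N \<le> real N * t" if "- 1 \<le> t" "t \<le> 1" for t
    using mult_left_mono[OF that(2), of "real N"] mult_left_mono[OF that(1), of "real N"] by simp_all
  show "closed_segment (vtx N 1 (- 1)) (vtx N 1 1) \<subseteq> region N - pts N"
  proof
    fix w assume "w \<in> closed_segment (vtx N 1 (- 1)) (vtx N 1 1)"
    then obtain u where u: "0 \<le> u" "u \<le> 1" "X w = real N * ((1 - u) * 1 + u * 1)" "Y w = real N * ((1 - u) * - 1 + u * 1)"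
      by (rule segment_coord)
    then have "X w = real N" "Y w = real N * (2 * u - 1)" by (simp_all add: algebra_simps)
    then show "w \<in> region N - pts N" using Nm[of "2 * u - 1"] u by (intro avoid) auto
  qed
  show "closed_segment (vtx N 1 1) (vtx N (- 1) 1) \<subseteq> region N - pts N"
  proof
    fix w assume "w \<in> closed_segment (vtx N 1 1) (vtx N (- 1) 1)"
    then obtain u where u: "0 \<le> u" "u \<le> 1" "X w = real N * ((1 - u) * 1 + u * - 1)" "Y w = real N * ((1 - u) * 1 + u * 1)"
      by (rule segment_coord)
    then have "Y w = real N" "X w = real N * (1 - 2 * u)" by (simp_all add: algebra_simps)
    then show "w \<in> region N - pts N" using Nm[of "1 - 2 * u"] u by (intro avoid) auto
  qed
  show "closed_segment (vtx N (- 1) 1) (vtx N 1 (- 1)) \<subseteq> region N - pts N"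
  proof
    fix w assume "w \<in> closed_segment (vtx N (- 1) 1) (vtx N 1 (- 1))"
    then obtain u where u: "0 \<le> u" "u \<le> 1" "X w = real N * ((1 - u) * - 1 + u * 1)" "Y w = real N * ((1 - u) * 1 + u * - 1)"
      by (rule segment_coord)
    then have "X w = real N * (2 * u - 1)" "Y w = real N * (1 - 2 * u)" by (simp_all add: algebra_simps)
    moreover from this have "X w \<le> real N" "Y w \<le> real N"
      using Nm(1)[of "2 * u - 1"] Nm(1)[of "1 - 2 * u"] u by simp_all
    moreover from calculation have "X w + Y w = 0" by (simp add: algebra_simps)
    ultimately show "w \<in> region N - pts N" by (intro avoid) auto
  qed
qed

private lemma k_odd: "k (- w) = - k w"
  by (simp add: k_def)

text \<open>The winding number -1 cancels the sign in the residues -r1 and -r2. The third side runs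
  from a point -v to v, so its integral vanishes by oddness.\<close>

private lemma residue_sum_eq:
  assumes "N > 0"
  shows "2 * of_real pi * \<i> * (\<Sum>n<N. r1 n + r2 n) =
    contour_integral (linepath (vtx N 1 (- 1)) (vtx N 1 1)) k +
    contour_integral (linepath (vtx N 1 1) (vtx N (- 1) 1)) k"
proof -
  note e = edge_avoids[OF assms]
  have int: "k contour_integrable_on linepath a b" if "closed_segment a b \<subseteq> region N - pts N" for a b
    using holomorphic_on_imp_continuous_on[OF k_holomorphic_region] that
    by (intro contour_integrable_continuous_linepath) (rule continuous_on_subset)
  have img: "path_image (tri N) \<subseteq> region N - pts N"
    using e by (auto simp: tri_def path_image_join)
  have fin: "finite (pts N)" by (simp add: pts_def)
  have "contour_integral (tri N) k =
      contour_integral (linepath (vtx N 1 (- 1)) (vtx N 1 1)) k +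
      contour_integral (linepath (vtx N 1 1) (vtx N (- 1) 1)) k +
      contour_integral (linepath (vtx N (- 1) 1) (vtx N 1 (- 1))) k"
    unfolding tri_def using int[OF e(1)] int[OF e(2)] int[OF e(3)] by simp
  moreover have "contour_integral (linepath (vtx N (- 1) 1) (vtx N 1 (- 1))) k = 0"
  proof -
    have v: "vtx N (- 1) 1 = - vtx N 1 (- 1)" by (simp add: vtx_def)
    show ?thesis
      using int[OF e(3)] unfolding v by (intro contour_integral_odd_symmetric_line k_odd)
  qed
  moreover have "contour_integral (tri N) k =
      2 * of_real pi * \<i> * (\<Sum>p\<in>pts N. winding_number (tri N) p * residue k p)"
  proof -
    have loop: "valid_path (tri N)" "pathfinish (tri N) = pathstart (tri N)"
      by (simp_all add: tri_def)
    have "\<forall>z. z \<notin> region N \<longrightarrow> winding_number (tri N) z = 0"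
      using img region_props(2) loop by (intro allI impI winding_number_zero_outside[of _ "region N"])
        (auto intro: valid_path_imp_path)
    from Residue_theorem[OF region_props(1) convex_connected[OF region_props(2)] fin k_holomorphic_region loop img this]
    show ?thesis by simp
  qed
  moreover have "(\<Sum>p\<in>pts N. winding_number (tri N) p * residue k p) = (\<Sum>p\<in>pts N. - residue k p)"
  proof (rule sum.cong)
    fix p assume "p \<in> pts N"
    from pts_coord[OF this] have "winding_number (tri N) p = - 1"
      using assms by (intro winding_tri) auto
    then show "winding_number (tri N) p * residue k p = - residue k p" by simp
  qed simp
  moreover have "(\<Sum>p\<in>pts N. - residue k p) = (\<Sum>n<N. r1 n + r2 n)"
  proof -
    have disj: "(\<lambda>n. of_nat n + 1/2) ` {..<N} \<inter> (\<lambda>n. (of_nat n + 1/2) * \<tau>') ` {..<N} = {}"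
    proof -
      have "of_nat n + 1/2 \<noteq> (of_nat m + 1/2) * \<tau>'" for n m
      proof
        assume a: "of_nat n + 1/2 = (of_nat m + 1/2) * \<tau>'"
        from arg_cong[OF a, of Im] have "(real m + 1/2) * Im \<tau>' = 0" by simp
        moreover have "real m + 1/2 \<noteq> 0" by linarith
        ultimately show False by simp
      qed
      then show ?thesis by blast
    qed
    have "(\<Sum>p\<in>pts N. - residue k p) = (\<Sum>p\<in>(\<lambda>n. of_nat n + 1/2) ` {..<N}. - residue k p) +
        (\<Sum>p\<in>(\<lambda>n. (of_nat n + 1/2) * \<tau>') ` {..<N}. - residue k p)"
      unfolding pts_def by (rule sum.union_disjoint[OF _ _ disj]) auto
    also have "(\<Sum>p\<in>(\<lambda>n. of_nat n + 1/2) ` {..<N}. - residue k p) = (\<Sum>n<N. r1 n)"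
      by (subst sum.reindex) (auto simp: inj_on_def residue_k_real)
    also have "(\<Sum>p\<in>(\<lambda>n. (of_nat n + 1/2) * \<tau>') ` {..<N}. - residue k p) = (\<Sum>n<N. r2 n)"
      by (subst sum.reindex) (auto simp: inj_on_def residue_k_tau)
    finally show ?thesis by (simp add: sum.distrib)
  qed
  ultimately show ?thesis by simp
qed

private lemma residue_sum_LIMSEQ: "(\<lambda>N. \<Sum>n<N. r1 n + r2 n) \<longlonglongrightarrow> 0"
proof -
  define a where "a = exp (- (pi * (1 - \<bar>B\<bar>) * \<bar>Im \<tau>\<bar>))"
  define b where "b = exp (- (pi * (1 - \<bar>A\<bar>) * \<bar>Im \<tau>'\<bar>))"
  have ab: "0 \<le> a" "a < 1" "0 \<le> b" "b < 1"
  proof -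
    have "0 < pi * (1 - \<bar>B\<bar>) * \<bar>Im \<tau>\<bar>" "0 < pi * (1 - \<bar>A\<bar>) * \<bar>Im \<tau>'\<bar>"
      using A B by (intro mult_pos_pos; simp)+
    then show "0 \<le> a" "a < 1" "0 \<le> b" "b < 1"
      unfolding a_def b_def by simp_all
  qed
  obtain C where C: "C > 0"
    "\<And>N y p. pi * (real N * \<bar>Im \<tau>\<bar>) \<ge> 1 \<Longrightarrow> Im p = pi * (A * (y * Im \<tau>') + B * (real N * Im \<tau>)) \<Longrightarrow>
      norm (sin p / (cos (of_real pi * (of_nat N + of_real y * \<tau>')) * cos (of_real pi * (of_nat N * \<tau> + of_real y))))
        \<le> C * a ^ N"
    unfolding a_def by (rule kernel_side_bound[OF Im_nz(2) Im_nz(1) A B]) (rule that[unfolded a_def])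
  obtain D where D: "D > 0"
    "\<And>N y p. pi * (real N * \<bar>Im \<tau>'\<bar>) \<ge> 1 \<Longrightarrow> Im p = pi * (B * (y * Im \<tau>) + A * (real N * Im \<tau>')) \<Longrightarrow>
      norm (sin p / (cos (of_real pi * (of_nat N + of_real y * \<tau>)) * cos (of_real pi * (of_nat N * \<tau>' + of_real y))))
        \<le> D * b ^ N"
    unfolding b_def by (rule kernel_side_bound[OF Im_nz(1) Im_nz(2) B A]) (rule that[unfolded b_def])
  \<comment> \<open>The cross term from \<tau> times 1/\<tau> is real. On each edge one coordinate
    is fixed at N, so A and B trade places between the two edges.\<close>
  have ws: "Im (of_real pi * (of_real x + of_real y * \<tau>') * s) = pi * (A * (y * Im \<tau>') + B * (x * Im \<tau>))" for x y
  proof -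
    have "of_real pi * (of_real x + of_real y * \<tau>') * s =
        of_real pi * (of_real A * (of_real x + of_real y * \<tau>') + of_real B * (of_real x * \<tau> + of_real y * (\<tau> * \<tau>')))"
      unfolding s_eq by (simp only: ring_distribs mult_ac add_ac)
    then show ?thesis by (simp only: tau_nz) simp
  qed
  have pi_mult: "norm (of_real pi * v) \<le> pi * M" if "norm v \<le> M" for v :: complex and M
    using that by (simp add: norm_mult)
  have tw: "\<tau> * (of_real x + of_real y * \<tau>') = of_real x * \<tau> + of_real y" for x y
    by (simp add: algebra_simps)
  have bound: "norm (2 * of_real pi * \<i> * (\<Sum>n<N. r1 n + r2 n)) \<le>
      pi * C * a ^ N * (2 * real N * norm \<tau>') + pi * D * b ^ N * (2 * real N)"
    if N: "N > 0" "pi * (real N * \<bar>Im \<tau>\<bar>) \<ge> 1" "pi * (real N * \<bar>Im \<tau>'\<bar>) \<ge> 1" for N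
  proof -
    note e = edge_avoids[OF N(1)]
    have int: "k contour_integrable_on linepath a b" if "closed_segment a b \<subseteq> region N - pts N" for a b
      using holomorphic_on_imp_continuous_on[OF k_holomorphic_region] that
      by (intro contour_integrable_continuous_linepath) (rule continuous_on_subset)
    have "norm (contour_integral (linepath (vtx N 1 (- 1)) (vtx N 1 1)) k) \<le>
        pi * C * a ^ N * norm (vtx N 1 1 - vtx N 1 (- 1))"
    proof (rule contour_integral_bound_linepath[OF int[OF e(1)]])
      fix w assume "w \<in> closed_segment (vtx N 1 (- 1)) (vtx N 1 1)"
      then obtain u where u: "X w = real N * ((1 - u) * 1 + u * 1)" by (rule segment_coord)
      define y where "y = Y w"
      have w: "w = of_real (real N) + of_real y * \<tau>'"
        using coord_eq[of w] u by (simp add: y_def)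
      have "k w = of_real pi * (sin (of_real pi * w * s) /
          (cos (of_real pi * (of_nat N + of_real y * \<tau>')) * cos (of_real pi * (of_nat N * \<tau> + of_real y))))"
        unfolding k_def w tw by simp
      moreover have "norm (sin (of_real pi * w * s) /
          (cos (of_real pi * (of_nat N + of_real y * \<tau>')) * cos (of_real pi * (of_nat N * \<tau> + of_real y)))) \<le> C * a ^ N"
        by (rule C(2)[OF N(2)]) (simp only: w ws)
      ultimately show "norm (k w) \<le> pi * C * a ^ N" by (metis pi_mult mult.assoc)
    qed (use C ab in auto)
    moreover have "vtx N 1 1 - vtx N 1 (- 1) = of_real (2 * real N) * \<tau>'"
      by (simp add: vtx_def algebra_simps)
    moreover have "norm (contour_integral (linepath (vtx N 1 1) (vtx N (- 1) 1)) k) \<le>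
        pi * D * b ^ N * norm (vtx N (- 1) 1 - vtx N 1 1)"
    proof (rule contour_integral_bound_linepath[OF int[OF e(2)]])
      fix w assume "w \<in> closed_segment (vtx N 1 1) (vtx N (- 1) 1)"
      then obtain u where u: "Y w = real N * ((1 - u) * 1 + u * 1)" by (rule segment_coord)
      define x where "x = X w"
      have w: "w = of_real x + of_real (real N) * \<tau>'"
        using coord_eq[of w] u by (simp add: x_def)
      have "k w = of_real pi * (sin (of_real pi * w * s) /
          (cos (of_real pi * (of_nat N + of_real x * \<tau>)) * cos (of_real pi * (of_nat N * \<tau>' + of_real x))))"
        unfolding k_def w tw by (simp add: add.commute mult.commute)
      moreover have "norm (sin (of_real pi * w * s) /
          (cos (of_real pi * (of_nat N + of_real x * \<tau>)) * cos (of_real pi * (of_nat N * \<tau>' + of_real x)))) \<le> D * b ^ N"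
        by (rule D(2)[OF N(3)]) (simp only: w ws add.commute)
      ultimately show "norm (k w) \<le> pi * D * b ^ N" by (metis pi_mult mult.assoc)
    qed (use D ab in auto)
    moreover have "vtx N (- 1) 1 - vtx N 1 1 = - of_real (2 * real N)"
      by (simp add: vtx_def algebra_simps)
    ultimately show ?thesis
      unfolding residue_sum_eq[OF N(1)]
      by (intro order_trans[OF norm_triangle_ineq] add_mono) (simp_all add: norm_mult)
  qed
  have lin: "(\<lambda>N. real N * c ^ N) \<longlonglongrightarrow> 0" if "0 \<le> c" "c < 1" for c :: real
    using powser_times_n_limit_0[of c] that by simp
  have "(\<lambda>N. 2 * of_real pi * \<i> * (\<Sum>n<N. r1 n + r2 n)) \<longlonglongrightarrow> 0"
  proof (rule Lim_null_comparison)
    have ev: "eventually (\<lambda>N. pi * (real N * c) \<ge> 1) sequentially" if "c > 0" for c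
      using that by real_asymp
    have "0 < \<bar>Im \<tau>\<bar>" "0 < \<bar>Im \<tau>'\<bar>" by simp_all
    from eventually_gt_at_top[of 0] this[THEN ev]
    show "eventually (\<lambda>N. norm (2 * of_real pi * \<i> * (\<Sum>n<N. r1 n + r2 n)) \<le>
        pi * C * a ^ N * (2 * real N * norm \<tau>') + pi * D * b ^ N * (2 * real N)) sequentially"
      by eventually_elim (rule bound)
    have "(\<lambda>N. 2 * pi * C * norm \<tau>' * (real N * a ^ N) + 2 * pi * D * (real N * b ^ N)) \<longlonglongrightarrow>
        2 * pi * C * norm \<tau>' * 0 + 2 * pi * D * 0"
      by (intro tendsto_intros lin ab)
    then show "(\<lambda>N. pi * C * a ^ N * (2 * real N * norm \<tau>') + pi * D * b ^ N * (2 * real N)) \<longlonglongrightarrow> 0"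
      by (simp add: mult_ac)
  qed
  then have "(\<lambda>N. (2 * of_real pi * \<i> * (\<Sum>n<N. r1 n + r2 n)) / (2 * of_real pi * \<i>)) \<longlonglongrightarrow> 0 / (2 * of_real pi * \<i>)"
    by (intro tendsto_divide tendsto_const) auto
  then show ?thesis by simp
qed

lemma half_odd_residue_sum_LIMSEQ:
  "(\<lambda>N. \<Sum>n<N. (- 1) ^ n * sin ((of_nat n + 1/2) * of_real pi * s) / cos ((of_nat n + 1/2) * of_real pi * \<tau>) +
     (- 1) ^ n * sin ((of_nat n + 1/2) * of_real pi * s / \<tau>) / (\<tau> * cos ((of_nat n + 1/2) * of_real pi / \<tau>))) \<longlonglongrightarrow> 0"
  using residue_sum_LIMSEQ unfolding r1_def r2_def .

end

subsection \<open>The two expansions\<close>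

text \<open>With p = q^(n+1/2), both sides are p / (1 + p^2) = 1 / (p + 1/p).\<close>

lemma cos_half_odd_pi_eq:
  assumes "Im \<tau> > 0"
  shows "nome_pow \<tau> (real n + 1/2) / (1 + nome_pow \<tau> (real (2 * n + 1))) =
    1/2 * (1 / cos ((of_nat n + 1/2) * of_real pi * \<tau>))"
proof -
  define p where "p = cispi (\<tau> * (of_nat n + 1/2))"
  have p: "p \<noteq> 0" by (simp add: p_def)
  have "cispi (\<tau> * (2 * of_nat n + 1)) = p * p" "cispi (\<tau> * (1 + 2 * of_nat n)) = p * p"
    unfolding p_def cispi_add[symmetric] by (simp_all add: algebra_simps)
  moreover have "1 + cispi (\<tau> * (2 * of_nat n + 1)) \<noteq> 0"
    using one_plus_cispi_odd_nonzero[of \<tau> "int n"] assms by simp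
  moreover have "cos ((of_nat n + 1/2) * of_real pi * \<tau>) = (p + inverse p) / 2"
    using cos_pi_eq_cispi[of "\<tau> * (of_nat n + 1/2)"] by (simp add: p_def cispi_minus mult_ac)
  moreover have "p + inverse p = (1 + p * p) / p"
    using p by (simp add: field_simps)
  ultimately show ?thesis
    using p by (simp add: nome_pow_eq_cispi p_def[symmetric])
qed

lemma CN_fourier_series:
  assumes tau: "Im \<tau> > 0" and z: "\<bar>Im z\<bar> < Im \<tau> / 2"
  shows "(\<lambda>n. nome_pow \<tau> (real n + 1/2) * cos (of_nat (2 * n + 1) * of_real pi * z) /
            (1 + nome_pow \<tau> (real (2 * n + 1)))) sums CN z \<tau>"
proof -
  have "(cn_term \<tau> z (int n) + cn_term \<tau> z (- int n - 1)) / 2 =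
      nome_pow \<tau> (real n + 1/2) * cos (of_nat (2 * n + 1) * of_real pi * z) /
            (1 + nome_pow \<tau> (real (2 * n + 1)))" for n
  proof -
    have c: "cos (of_nat (2 * n + 1) * of_real pi * z) =
        (cispi ((2 * of_nat n + 1) * z) + cispi ((2 * of_nat n + 1) * - z)) / 2"
    proof -
      have e: "of_nat (2 * n + 1) * of_real pi * z = of_real pi * ((2 * of_nat n + 1) * z)"
        by (simp add: algebra_simps)
      show ?thesis unfolding e cos_pi_eq_cispi by simp
    qed
    have k: "cn_coeff \<tau> (int n) = nome_pow \<tau> (real n + 1/2) / (1 + nome_pow \<tau> (real (2 * n + 1)))"
      by (simp add: cn_coeff_def nome_pow_eq_cispi add.commute)
    have "cn_term \<tau> z (- int n - 1) = cn_term \<tau> (- z) (int n)"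
      using tau by (intro cn_term_reflect) simp
    then have t: "cn_term \<tau> z (int n) = cn_coeff \<tau> (int n) * cispi ((2 * of_nat n + 1) * z)"
      "cn_term \<tau> z (- int n - 1) = cn_coeff \<tau> (int n) * cispi ((2 * of_nat n + 1) * - z)"
      by (simp_all add: cn_term_def)
    have "(x / d * a + x / d * b) / 2 = x * ((a + b) / 2) / d" for x d a b :: complex
      by (cases "d = 0") (simp_all add: field_simps)
    then show ?thesis unfolding t k c .
  qed
  moreover have "(\<lambda>n. (cn_term \<tau> z (int n) + cn_term \<tau> z (- int n - 1)) / 2) sums CN z \<tau>"
    unfolding CN_eq_infsum[OF assms]
    by (intro sums_divide int_sums_paired cn_term_summable assms)
  ultimately show ?thesis by (simp only:)
qed

lemma CN_cos_series:
  assumes tau: "Im \<tau> > 0" and z: "\<bar>Im z\<bar> < Im \<tau> / 2"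
  shows "(\<lambda>n. cos (of_nat (2 * n + 1) * of_real pi * z) / cos ((of_nat n + 1/2) * of_real pi * \<tau>)) sums (2 * CN z \<tau>)"
proof -
  have "2 * (nome_pow \<tau> (real n + 1/2) * cos (of_nat (2 * n + 1) * of_real pi * z) /
            (1 + nome_pow \<tau> (real (2 * n + 1)))) =
      cos (of_nat (2 * n + 1) * of_real pi * z) / cos ((of_nat n + 1/2) * of_real pi * \<tau>)" for n
  proof -
    have "2 * (a * c / b) = c / d" if "a / b = 1/2 * (1 / d)" for a b c d :: complex
    proof -
      have "2 * (a * c / b) = 2 * c * (a / b)" by simp
      also have "\<dots> = c / d" unfolding that by simp
      finally show ?thesis .
    qed
    from this[OF cos_half_odd_pi_eq[OF tau]] show ?thesis .
  qed
  then show ?thesis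
    using sums_mult[OF CN_fourier_series[OF assms], of 2] by simp
qed

text \<open>Both theta functions acquire the same quasi-periodicity factor: cispi z compensates the
  offset \<tau>/2, and the offset 1/2 leaves the sign (-1)^m.\<close>

lemma CN_shift:
  assumes tau: "Im \<tau> > 0"
  shows "CN (z + of_int m * \<tau>) \<tau> = (- 1) powi m * CN z \<tau>"
proof -
  define f where "f = cispi (- \<tau> * (of_int m)\<^sup>2 - 2 * of_int m * (z + 1/2))"
  have 1: "theta \<tau> (z + of_int m * \<tau> + 1/2) = f * theta \<tau> (z + 1/2)"
    using theta_shift[of \<tau> "z + 1/2" m] by (simp add: f_def add_ac)
  have 2: "cispi (z + of_int m * \<tau>) * theta \<tau> (z + of_int m * \<tau> + \<tau> / 2) =
      f * ((- 1) powi m * (cispi z * theta \<tau> (z + \<tau> / 2)))"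
  proof -
    have "cispi (z + of_int m * \<tau>) * cispi (- \<tau> * (of_int m)\<^sup>2 - 2 * of_int m * (z + \<tau> / 2)) =
        f * cispi (of_int m) * cispi z"
      unfolding f_def cispi_add[symmetric] by (simp add: algebra_simps)
    then show ?thesis
      using theta_shift[of \<tau> "z + \<tau> / 2" m] by (simp add: cispi_of_int mult_ac add_ac)
  qed
  have "f \<noteq> 0" by (simp add: f_def)
  then show ?thesis
    unfolding CN_eq_theta[OF tau] 1 2 by simp
qed

section \<open>Extension of the sine series to all real \<beta>\<close>

context
  fixes \<tau> :: complex and \<alpha> :: real
  assumes tau: "Im \<tau> > 0" and \<alpha>: "\<bar>\<alpha>\<bar> < 1/2"
begin

private definition "z \<beta> = 1/2 + of_real \<alpha> + of_real \<beta> * \<tau>" for \<beta> :: real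

private definition "g \<beta> n = (- 1) ^ n * sin ((of_nat n + 1/2) * of_real pi * (2 * z \<beta> - 1) / \<tau>) /
   cos ((of_nat n + 1/2) * of_real pi / \<tau>)" for \<beta> :: real

private lemma tau_neq_0: "\<tau> \<noteq> 0"
  using tau by auto

private lemma Im_inverse: "Im (inverse \<tau>) \<noteq> 0"
  using tau by (auto simp: divide_eq_0_iff sum_power2_eq_zero_iff)

text \<open>Division by \<tau> turns \<beta> into a real translation of the argument, so the size of
  the sine is controlled by \<alpha> and one majorant serves every \<beta>.\<close>

private lemma g_arg: "(of_nat n + 1/2) * of_real pi * (2 * z \<beta> - 1) / \<tau> =
    of_real (2 * \<alpha> * (pi * (real n + 1/2))) * inverse \<tau> + of_real (2 * \<beta> * (pi * (real n + 1/2)))"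
proof -
  have "2 * z \<beta> - 1 = 2 * of_real \<alpha> + 2 * of_real \<beta> * \<tau>" by (simp add: z_def algebra_simps)
  then show ?thesis using tau_neq_0 by (simp add: field_simps)
qed

text \<open>With x = pi |Im (1/\<tau>)| (n + 1/2), the sine is at most exp (2|\<alpha>| x) and the
  cosine at least a constant times exp x; as |\<alpha>| < 1/2, the quotient decays
  geometrically.\<close>

private lemma g_bound:
  obtains M where "summable M" "\<And>\<beta> n. norm (g \<beta> n) \<le> M n"
proof -
  define c where "c = \<bar>Im (inverse \<tau>)\<bar>"
  define t where "t = exp (- (pi * c * (1 - 2 * \<bar>\<alpha>\<bar>)))"
  obtain C where C: "C > 0"
    "\<And>y :: real. exp (pi * \<bar>y * Im (inverse \<tau>)\<bar>) \<le> C * norm (cos (of_real pi * (of_real y * inverse \<tau>)))"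
    by (rule cos_ray_lower_bound[OF Im_inverse]) (rule that)
  have "norm (g \<beta> n) \<le> C * (exp (- (pi * c * (1 - 2 * \<bar>\<alpha>\<bar>) / 2)) * t ^ n)" for \<beta> n
  proof -
    define D where "D = norm (cos ((of_nat n + 1/2) * of_real pi / \<tau>))"
    have "of_real pi * (of_real (real n + 1/2) * inverse \<tau>) = (of_nat n + 1/2) * of_real pi / \<tau>"
      using tau_neq_0 by (simp add: field_simps)
    with C(2)[of "real n + 1/2"] have CD: "exp (pi * c * (real n + 1/2)) \<le> C * D"
      by (simp add: D_def c_def abs_mult mult_ac)
    have "0 < C * D" by (rule less_le_trans[OF _ CD]) simp
    then have D: "D > 0" using C(1) by (simp add: zero_less_mult_iff)
    have "\<bar>Im ((of_nat n + 1/2) * of_real pi * (2 * z \<beta> - 1) / \<tau>)\<bar> = 2 * \<bar>\<alpha>\<bar> * (pi * c * (real n + 1/2))"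
      unfolding g_arg by (simp add: c_def abs_mult)
    then have "norm (sin ((of_nat n + 1/2) * of_real pi * (2 * z \<beta> - 1) / \<tau>)) \<le> exp (2 * \<bar>\<alpha>\<bar> * (pi * c * (real n + 1/2)))"
      using norm_sin_le_exp[of "(of_nat n + 1/2) * of_real pi * (2 * z \<beta> - 1) / \<tau>"] by simp
    then have "norm (g \<beta> n) \<le> exp (2 * \<bar>\<alpha>\<bar> * (pi * c * (real n + 1/2))) / D"
      unfolding g_def norm_divide norm_mult D_def[symmetric]
      using D by (simp add: norm_power divide_right_mono)
    also have "\<dots> \<le> exp (2 * \<bar>\<alpha>\<bar> * (pi * c * (real n + 1/2))) / (exp (pi * c * (real n + 1/2)) / C)"
      using CD C(1) D by (intro divide_left_mono) (auto simp: field_simps)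
    also have "\<dots> = C * exp (2 * \<bar>\<alpha>\<bar> * (pi * c * (real n + 1/2)) - pi * c * (real n + 1/2))"
      by (simp add: exp_diff)
    also have "2 * \<bar>\<alpha>\<bar> * (pi * c * (real n + 1/2)) - pi * c * (real n + 1/2) =
        - (pi * c * (1 - 2 * \<bar>\<alpha>\<bar>) / 2) + real n * - (pi * c * (1 - 2 * \<bar>\<alpha>\<bar>))"
      by (simp add: field_simps)
    finally show ?thesis
      unfolding t_def exp_add exp_of_nat_mult .
  qed
  moreover have "summable (\<lambda>n. C * (exp (- (pi * c * (1 - 2 * \<bar>\<alpha>\<bar>) / 2)) * t ^ n))"
  proof -
    have "0 < c" unfolding c_def zero_less_abs_iff by (rule Im_inverse)
    then have "0 < pi * c * (1 - 2 * \<bar>\<alpha>\<bar>)"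
      using \<alpha> by (intro mult_pos_pos) auto
    then have "t < 1" "t > 0" by (simp_all add: t_def)
    then show ?thesis by (intro summable_mult summable_geometric) simp
  qed
  ultimately show ?thesis using that by blast
qed

private lemma g_summable: "summable (g \<beta>)"
proof -
  obtain M where M: "summable M" "\<And>\<beta> n. norm (g \<beta> n) \<le> M n" by (rule g_bound) (rule that)
  then show ?thesis by (intro summable_comparison_test'[OF M(1)]) auto
qed

text \<open>The defect of the sine expansion, viewed as a function of \<beta> alone with \<alpha>
  fixed.\<close>

private definition "H \<beta> = CN (z \<beta>) \<tau> - 1 / (2 * \<tau>) * (\<Sum>n. g \<beta> n)"

private lemma H_zero_interior:
  assumes "\<bar>\<beta>\<bar> < 1/2"
  shows "H \<beta> = 0"
proof -
  have "\<bar>Im (z \<beta>)\<bar> < Im \<tau> / 2"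
  proof -
    have "\<bar>Im (z \<beta>)\<bar> = \<bar>\<beta>\<bar> * Im \<tau>" using tau by (simp add: z_def abs_mult)
    also have "\<dots> < 1/2 * Im \<tau>" using assms tau by (intro mult_strict_right_mono) auto
    finally show ?thesis by simp
  qed
  note S = CN_cos_series[OF tau this]
  have s: "2 * z \<beta> - 1 = of_real (2 * \<alpha>) + of_real (2 * \<beta>) * \<tau>"
    by (simp add: z_def algebra_simps)
  have "(\<lambda>N. \<Sum>n<N. (- 1) ^ n * sin ((of_nat n + 1/2) * of_real pi * (2 * z \<beta> - 1)) / cos ((of_nat n + 1/2) * of_real pi * \<tau>) +
     (- 1) ^ n * sin ((of_nat n + 1/2) * of_real pi * (2 * z \<beta> - 1) / \<tau>) / (\<tau> * cos ((of_nat n + 1/2) * of_real pi / \<tau>))) \<longlonglongrightarrow> 0"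
    using \<alpha> assms by (intro half_odd_residue_sum_LIMSEQ[OF tau refl s]) auto
  \<comment> \<open>The identity cos (a + pi (n + 1/2)) = -(-1)^n sin a turns the first half of the
    residue sum into the cosine series.\<close>
  moreover have "(- 1) ^ n * sin ((of_nat n + 1/2) * of_real pi * (2 * z \<beta> - 1)) =
      - cos (of_nat (2 * n + 1) * of_real pi * z \<beta>)" for n
  proof -
    have e: "of_nat (2 * n + 1) * of_real pi * z \<beta> =
        (of_nat n + 1/2) * of_real pi * (2 * z \<beta> - 1) + of_real pi * (of_nat n + 1/2)"
      by (simp add: algebra_simps)
    have c: "cos (of_real pi * (of_nat n + 1/2)) = (0 :: complex)"
      unfolding cos_pi_eq_0_iff by (rule exI[of _ "int n"]) simp
    show ?thesis
      unfolding e cos_add c sin_half_odd_pi by simp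
  qed
  ultimately have "(\<lambda>n. - (cos (of_nat (2 * n + 1) * of_real pi * z \<beta>) / cos ((of_nat n + 1/2) * of_real pi * \<tau>)) +
     1 / \<tau> * g \<beta> n) sums 0"
    unfolding sums_def g_def by (simp add: mult_ac)
  moreover have "(\<lambda>n. - (cos (of_nat (2 * n + 1) * of_real pi * z \<beta>) / cos ((of_nat n + 1/2) * of_real pi * \<tau>)) +
     1 / \<tau> * g \<beta> n) sums (- (2 * CN (z \<beta>) \<tau>) + 1 / \<tau> * (\<Sum>n. g \<beta> n))"
    by (intro sums_add sums_minus sums_mult S summable_sums g_summable)
  ultimately have "0 = - (2 * CN (z \<beta>) \<tau>) + 1 / \<tau> * (\<Sum>n. g \<beta> n)"
    by (rule sums_unique2)
  then show ?thesis
    using tau_neq_0 by (simp add: H_def field_simps)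
qed

private lemma H_continuous: "continuous_on UNIV H"
proof -
  obtain M where M: "summable M" "\<And>\<beta> n. norm (g \<beta> n) \<le> M n" by (rule g_bound) (rule that)
  have z: "continuous_on UNIV z" unfolding z_def by (intro continuous_intros)
  have th: "continuous_on UNIV (\<lambda>\<beta>. theta \<tau> (z \<beta> + c))" for c
  proof (rule continuous_on_compose2[of UNIV "theta \<tau>"])
    show "continuous_on UNIV (theta \<tau>)"
      by (simp add: continuous_at_imp_continuous_on isCont_theta[OF tau])
    show "continuous_on UNIV (\<lambda>\<beta>. z \<beta> + c)"
      by (intro continuous_intros z)
  qed simp
  have "continuous_on UNIV (\<lambda>\<beta>. \<Sum>n. g \<beta> n)"
  proof (rule uniform_limit_theorem[OF _ Weierstrass_m_test[OF M(2,1)]])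
    show "eventually (\<lambda>n. continuous_on UNIV (\<lambda>\<beta>. \<Sum>i<n. g \<beta> i)) sequentially"
      unfolding g_def divide_inverse by (intro always_eventually allI continuous_intros z)
  qed simp
  \<comment> \<open>This denominator can vanish only for half-odd \<alpha>, so the whole line of
    \<beta> is free of poles, also outside the strip.\<close>
  moreover have "theta \<tau> (z \<beta> + 1/2) \<noteq> 0" for \<beta>
  proof (rule theta_nonzero_real_part[OF tau])
    show "z \<beta> + 1/2 = of_real (1 + \<alpha>) + of_real \<beta> * \<tau>" by (simp add: z_def)
    have "1 + \<alpha> \<noteq> of_int n + 1/2" for n :: int
    proof
      assume "1 + \<alpha> = of_int n + 1/2"
      with \<alpha> have "real_of_int 0 < of_int n" "real_of_int n < of_int 1" by (simp_all add: abs_less_iff)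
      then show False unfolding of_int_less_iff by simp
    qed
    then show "(\<forall>n :: int. 1 + \<alpha> \<noteq> of_int n + 1/2) \<or> (\<forall>n :: int. \<beta> \<noteq> of_int n + 1/2)" by blast
  qed
  ultimately show ?thesis
    unfolding H_def CN_eq_theta[OF tau] cispi_def
    using th tau_neq_0 by (intro continuous_intros z) auto
qed

text \<open>The argument of the n-th sine moves by (2n+1) m pi, and 2n+1 is odd, so every term
  changes by the same sign (-1)^m as CN.\<close>

private lemma H_shift: "H (\<beta> + of_int m) = (- 1) powi m * H \<beta>"
proof -
  have "z (\<beta> + of_int m) = z \<beta> + of_int m * \<tau>" by (simp add: z_def algebra_simps)
  then have 1: "CN (z (\<beta> + of_int m)) \<tau> = (- 1) powi m * CN (z \<beta>) \<tau>"
    by (simp add: CN_shift[OF tau])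
  have "g (\<beta> + of_int m) n = (- 1) powi m * g \<beta> n" for n
  proof -
    have e: "(of_nat n + 1/2) * of_real pi * (2 * z (\<beta> + of_int m) - 1) / \<tau> =
        (of_nat n + 1/2) * of_real pi * (2 * z \<beta> - 1) / \<tau> + of_real (of_int ((2 * int n + 1) * m) * pi)"
      unfolding g_arg by (simp add: algebra_simps)
    have "cos (of_int ((2 * int n + 1) * m) * pi) = (- 1) powi m" "sin (of_int ((2 * int n + 1) * m) * pi) = 0"
    proof -
      show "sin (of_int ((2 * int n + 1) * m) * pi) = 0"
        using sin_npi_int[of "(2 * int n + 1) * m"] by (simp only: mult.commute)
      have "cos (of_int ((2 * int n + 1) * m) * pi) = (if even m then 1 else - 1)"
        using cos_npi_int[of "(2 * int n + 1) * m"] by (simp add: mult.commute)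
      then show "cos (of_int ((2 * int n + 1) * m) * pi) = (- 1) powi m"
        by (auto simp: power_int_minus_left)
    qed
    then show ?thesis
      unfolding g_def e sin_add cos_of_real sin_of_real by (simp add: mult_ac)
  qed
  then have "(\<Sum>n. g (\<beta> + of_int m) n) = (- 1) powi m * (\<Sum>n. g \<beta> n)"
    by (simp add: suminf_mult[OF g_summable])
  then show ?thesis
    unfolding H_def 1 by (simp add: algebra_simps)
qed

private lemma H_zero: "H \<beta> = 0"
proof -
  define m where "m = \<lfloor>\<beta> + 1/2\<rfloor>"
  define \<gamma> where "\<gamma> = \<beta> - of_int m"
  have "real_of_int m \<le> \<beta> + 1/2" "\<beta> + 1/2 < real_of_int m + 1"
    unfolding m_def by linarith+
  then have "\<gamma> \<in> {- (1/2)..1/2}" by (auto simp: \<gamma>_def)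
  \<comment> \<open>The value \<gamma> = -1/2 occurs and lies outside the open interval; continuity
    supplies it.\<close>
  also have "{- (1/2)..1/2} = closure {- (1/2)<..<1/2 :: real}" by simp
  finally have "H \<gamma> = 0"
  proof (rule continuous_constant_on_closure[rotated -1])
    show "continuous_on (closure {- (1/2)<..<1/2}) H"
      using H_continuous by (rule continuous_on_subset) simp
    show "H x = 0" if "x \<in> {- (1/2)<..<1/2}" for x
      using that by (intro H_zero_interior) (auto simp: abs_less_iff)
  qed
  then show ?thesis
    using H_shift[of \<gamma> m] by (simp add: \<gamma>_def)
qed

lemma CN_sin_series:
  assumes "w = 1/2 + of_real \<alpha> + of_real \<beta> * \<tau>"
  shows "CN w \<tau> = 1 / (2 * \<tau>) * (\<Sum>n. (- 1) ^ n * sin ((of_nat n + 1/2) * of_real pi * (2 * w - 1) / \<tau>) /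
      cos ((of_nat n + 1/2) * of_real pi / \<tau>))"
    "summable (\<lambda>n. (- 1) ^ n * sin ((of_nat n + 1/2) * of_real pi * (2 * w - 1) / \<tau>) /
      cos ((of_nat n + 1/2) * of_real pi / \<tau>))"
proof -
  have w: "w = z \<beta>" by (simp add: assms z_def)
  show "CN w \<tau> = 1 / (2 * \<tau>) * (\<Sum>n. (- 1) ^ n * sin ((of_nat n + 1/2) * of_real pi * (2 * w - 1) / \<tau>) /
      cos ((of_nat n + 1/2) * of_real pi / \<tau>))"
    using H_zero[of \<beta>] unfolding H_def g_def w by simp
  show "summable (\<lambda>n. (- 1) ^ n * sin ((of_nat n + 1/2) * of_real pi * (2 * w - 1) / \<tau>) /
      cos ((of_nat n + 1/2) * of_real pi / \<tau>))"
    using g_summable[of \<beta>] unfolding g_def w .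
qed

end

text \<open>An infinite sum is informative only if it converges, so each expansion carries its
  convergence, through \<open>sums\<close> or \<open>summable\<close>.\<close>

theorem mainTheorem6:
  fixes \<tau> z :: complex and \<alpha> \<beta> :: real
  assumes "Im \<tau> > 0"
    and "z = 1/2 + of_real \<alpha> + of_real \<beta> * \<tau>"
  shows "(\<bar>\<beta>\<bar> < 1/2 \<longrightarrow>
            (\<lambda>n. nome_pow \<tau> (real n + 1/2) * cos (of_nat (2 * n + 1) * of_real pi * z) /
                 (1 + nome_pow \<tau> (real (2 * n + 1)))) sums CN z \<tau> \<and>
            CN z \<tau> =
              1/2 * (\<Sum>n. cos (of_nat (2 * n + 1) * of_real pi * z) /
                          cos ((of_nat n + 1/2) * of_real pi * \<tau>)) \<and>
            summable (\<lambda>n. cos (of_nat (2 * n + 1) * of_real pi * z) /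
                          cos ((of_nat n + 1/2) * of_real pi * \<tau>))) \<and>
         (\<bar>\<alpha>\<bar> < 1/2 \<longrightarrow>
            CN z \<tau> =
              1 / (2 * \<tau>) * (\<Sum>n. (-1) ^ n * sin ((of_nat n + 1/2) * of_real pi * (2 * z - 1) / \<tau>) /
                                  cos ((of_nat n + 1/2) * of_real pi / \<tau>)) \<and>
            summable (\<lambda>n. (-1) ^ n * sin ((of_nat n + 1/2) * of_real pi * (2 * z - 1) / \<tau>) /
                          cos ((of_nat n + 1/2) * of_real pi / \<tau>)))"
proof (intro conjI[of "\<bar>\<beta>\<bar> < 1/2 \<longrightarrow> _"] impI)
  assume "\<bar>\<beta>\<bar> < 1/2"
  have "\<bar>Im z\<bar> = \<bar>\<beta>\<bar> * Im \<tau>" using assms by (simp add: abs_mult)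
  also have "\<dots> < 1/2 * Im \<tau>" using \<open>\<bar>\<beta>\<bar> < 1/2\<close> assms(1) by (intro mult_strict_right_mono) auto
  finally have "\<bar>Im z\<bar> < Im \<tau> / 2" by simp
  note fourier = CN_fourier_series[OF assms(1) this] and cos = CN_cos_series[OF assms(1) this]
  show "(\<lambda>n. nome_pow \<tau> (real n + 1/2) * cos (of_nat (2 * n + 1) * of_real pi * z) /
                 (1 + nome_pow \<tau> (real (2 * n + 1)))) sums CN z \<tau> \<and>
            CN z \<tau> =
              1/2 * (\<Sum>n. cos (of_nat (2 * n + 1) * of_real pi * z) /
                          cos ((of_nat n + 1/2) * of_real pi * \<tau>)) \<and>
            summable (\<lambda>n. cos (of_nat (2 * n + 1) * of_real pi * z) /
                          cos ((of_nat n + 1/2) * of_real pi * \<tau>))"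
    using fourier sums_summable[OF cos] unfolding sums_unique[OF cos, symmetric] by simp
next
  assume "\<bar>\<alpha>\<bar> < 1/2"
  from CN_sin_series[OF assms(1) this assms(2)]
  show "CN z \<tau> =
              1 / (2 * \<tau>) * (\<Sum>n. (-1) ^ n * sin ((of_nat n + 1/2) * of_real pi * (2 * z - 1) / \<tau>) /
                                  cos ((of_nat n + 1/2) * of_real pi / \<tau>)) \<and>
            summable (\<lambda>n. (-1) ^ n * sin ((of_nat n + 1/2) * of_real pi * (2 * z - 1) / \<tau>) /
                          cos ((of_nat n + 1/2) * of_real pi / \<tau>))"
    by blast
qed

end
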